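(* Let $k\ge2$ and let $c,T,\tau>0$. Define $g:[0,T]\to\mathbb{R}$ by $g(t):=\frac1{c+(k-1)t}$, and set $$m_2:=\int_0^Tg(t)^2\,dt,\qquad \mu:=\frac1{m_2}\int_0^Ttg(t)^2\,dt,\qquad \sigma^2:=\frac1{m_2}\int_0^Tt^2g(t)^2\,dt-\mu^2.$$ Assume $$k\mu\le1-\tau,\qquad k\mu<1-T,\qquad k\sigma^2<(1+\tau-k\mu)^2.$$ Then $$\frac k{k-1}\log k-M_k^{[T]}\le\frac k{k-1}\cdot\frac{Z+Z_3+WX+VU}{(1+\tau/2)\big(1-\frac{k\sigma^2}{(1+\tau-k\mu)^2}\big)},$$ where $$Z:=\frac1\tau\int_1^{1+\tau}\Big(r\Big(\log\frac{r-k\mu}T+\frac{k\sigma^2}{4(r-k\mu)^2\log\frac{r-k\mu}T}\Big)+\frac{r^2}{4kT}\Big)dr,$$ $$Z_3:=\frac1{m_2}\int_0^Tkt\log\Big(1+\frac tT\Big)g(t)^2\,dt,\qquad W:=\frac1{m_2}\int_0^T\log\Big(1+\frac\tau{kt}\Big)g(t)^2\,dt,$$ $$X:=\frac{\log k}\tau c^2,\qquad V:=\frac c{m_2}\int_0^T\frac1{2c+(k-1)t}g(t)^2\,dt,$$ $$U:=\frac{\log k}c\int_0^1\Big((1+u\tau-(k-1)\mu-c)^2+(k-1)\sigma^2\Big)du.$$ The same bound holds with $M_k^{[T]}$ replaced by $M_k$.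
   Context: For square-integrable $F:[0,\infty)^k\to\mathbb{R}$, $I(F)=\int_{[0,\infty)^k}F^2$ and $$J_i(F)=\int_{[0,\infty)^{k-1}}\big(\int_0^\infty F\,dt_i\big)^2\prod_{j\ne i}dt_j.$$ $M_k$ is the supremum of $\sum_iJ_i(F)/I(F)$ over not identically zero square-integrable $F$ supported on $\{t\in[0,\infty)^k:\sum t_i\le1\}$. For $\alpha>0$, $M_k^{[\alpha]}$ is the same supremum over $F$ supported in $\{t\in[0,\alpha]^k:\sum t_i\le1\}$. *)

theory Defs
  imports "HOL-Analysis.Analysis"
begin

text \<open>Lebesgue measure on \<open>[0,\<infinity>)\<close>, and on \<open>[0,\<infinity>)\<^sup>A\<close> for a finite set \<open>A\<close> of coordinate indices.
  Points of \<open>[0,\<infinity>)\<^sup>k\<close> are extensional functions on \<open>{..<k}\<close>, so that the dimension is a value.\<close>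

definition half_line :: "real measure" where
  "half_line = restrict_space lborel {0..}"

definition orthant :: "nat set \<Rightarrow> (nat \<Rightarrow> real) measure" where
  "orthant A = PiM A (\<lambda>_. half_line)"

definition square_integrable :: "nat \<Rightarrow> ((nat \<Rightarrow> real) \<Rightarrow> real) \<Rightarrow> bool" where
  "square_integrable k F \<longleftrightarrow>
     F \<in> borel_measurable (orthant {..<k}) \<and> integrable (orthant {..<k}) (\<lambda>t. (F t)\<^sup>2)"

definition I_int :: "nat \<Rightarrow> ((nat \<Rightarrow> real) \<Rightarrow> real) \<Rightarrow> real" where
  "I_int k F = (\<integral>t. (F t)\<^sup>2 \<partial>orthant {..<k})"

text \<open>The integrals below are Bochner integrals, with value 0 where they diverge. For square-integrable
  \<open>F\<close> supported in the simplex, the inner one diverges at most on a null set and the outer one never,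
  by Cauchy--Schwarz.\<close>

definition J_int :: "nat \<Rightarrow> nat \<Rightarrow> ((nat \<Rightarrow> real) \<Rightarrow> real) \<Rightarrow> real" where
  "J_int k i F = (\<integral>t. (\<integral>s. F (t(i := s)) \<partial>half_line)\<^sup>2 \<partial>orthant ({..<k} - {i}))"

definition simplex_region :: "nat \<Rightarrow> (nat \<Rightarrow> real) set" where
  "simplex_region k = {t \<in> {..<k} \<rightarrow>\<^sub>E {0..}. (\<Sum>i<k. t i) \<le> 1}"

definition truncated_simplex_region :: "nat \<Rightarrow> real \<Rightarrow> (nat \<Rightarrow> real) set" where
  "truncated_simplex_region k \<alpha> = {t \<in> {..<k} \<rightarrow>\<^sub>E {0..\<alpha>}. (\<Sum>i<k. t i) \<le> 1}"

text \<open>``Not identically zero'' is meant in \<open>L\<^sup>2\<close>, i.e. up to null sets, so that \<open>I_int k F > 0\<close>.\<close>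

definition admissible :: "nat \<Rightarrow> (nat \<Rightarrow> real) set \<Rightarrow> ((nat \<Rightarrow> real) \<Rightarrow> real) set" where
  "admissible k S = {F. square_integrable k F
      \<and> (\<forall>t \<in> space (orthant {..<k}). t \<notin> S \<longrightarrow> F t = 0)
      \<and> \<not> (AE t in orthant {..<k}. F t = 0)}"

text \<open>The suprema are taken in the extended reals, where they exist without a boundedness argument.\<close>

definition M_sup :: "nat \<Rightarrow> ereal" where
  "M_sup k = (SUP F \<in> admissible k (simplex_region k).
     ereal ((\<Sum>i<k. J_int k i F) / I_int k F))"

definition M_trunc :: "nat \<Rightarrow> real \<Rightarrow> ereal" where
  "M_trunc k \<alpha> = (SUP F \<in> admissible k (truncated_simplex_region k \<alpha>).
     ereal ((\<Sum>i<k. J_int k i F) / I_int k F))"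

end

theory Submission
  imports Defs "HOL-Probability.Probability" "HOL-Real_Asymp.Real_Asymp"
begin

text \<open>
  For \<open>1 \<le> r \<le> 1 + \<tau>\<close> the function \<open>F(t) = 1\<^bsub>\<Sum>t \<le> r\<^esub> \<Prod>g(t\<^sub>i)\<close>, dilated by \<open>1/r\<close>, is admissible for
  \<open>M_trunc\<close>. If \<open>t\<^sub>1,\<dots>,t\<^sub>k\<close> are independent with density \<open>g\<^sup>2 / m\<^sub>2\<close> on \<open>[0,T]\<close> and \<open>S\<close> is their sum,
  this gives \<open>\<Sum>\<^sub>i E G(r - S + t\<^sub>i)\<^sup>2 \<le> m\<^sub>2 r M P(S \<le> r)\<close> with \<open>G(a) = \<integral>\<^sub>0\<^bsup>min a T\<^esup> g\<close>.

  Conversely \<open>G(a)\<^sup>2\<close> is almost as large as Cauchy--Schwarz with the weight \<open>w = a + (k - 1) t\<close> permits: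
  the loss comes from \<open>g \<noteq> 1/w\<close>, which costs \<open>\<integral> (a - c)\<^sup>2 g\<^sup>2 / w\<close>, and from the truncation at \<open>T\<close>, which costs
  a factor \<open>log\<^sub>+ (a / T)\<close>. Since the \<open>k\<close> weights add up to \<open>k r\<close>, summing over \<open>i\<close> bounds
  \<open>r P(S \<le> r) (k/(k-1) log k - M)\<close> by the total loss. Finally \<open>r\<close> is averaged over \<open>[1, 1 + \<tau>]\<close>: on the
  left a Chebyshev-type inequality produces the denominator, and on the right the average tames the
  singularity of \<open>c\<^sup>2 / w\<close>.
\<close>

section \<open>The probability measure with density proportional to \<open>g\<^sup>2\<close>\<close>

text \<open>The weight \<open>w = a + (k - 1) t\<close> is the one whose reciprocal has integral
  exactly \<open>log k / (k - 1)\<close> over \<open>[0, a]\<close>, whatever \<open>a\<close> is.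
  Together with the constant sum of the weights this makes \<open>k/(k-1) log k\<close> the natural
  ceiling. Equality in Cauchy--Schwarz would need \<open>g\<close> proportional to
  \<open>1 / w\<close>, hence dependent on \<open>a\<close>, which a product function cannot offer;
  \<open>g\<close> is \<open>1 / w\<close> for the single value \<open>a = c\<close>, and the price
  is governed by the distance of \<open>a\<close> from \<open>c\<close>.

  The obstacle is that \<open>(a - c)^2 / w\<close> behaves like \<open>c^2 / w\<close> when
  \<open>a\<close> and \<open>t\<close> are both small, and the expectation of \<open>1 / w\<close>
  is not controlled at a fixed scale. Losses are therefore collected as extended non-negative
  integrals, where a possibly infinite term is harmless, and finiteness appears only after
  integration over the scale.

  In the denominator, \<open>1 + \<tau> / 2\<close> is the mean of the scale over
  \<open>[1, 1 + \<tau>]\<close>, and the other factor is the bound of Chebyshev for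
  \<open>S\<close> at the endpoint \<open>1 + \<tau>\<close>, where it is cheapest.\<close>

locale weight =
  fixes k :: nat and c T :: real
  assumes k: "k \<ge> 2" and c: "c > 0" and T: "T > 0"
begin

definition g :: "real \<Rightarrow> real" where
  "g t = 1 / (c + (real k - 1) * t)"

definition m\<^sub>2 :: real where
  "m\<^sub>2 = (LBINT t:{0..T}. (g t)\<^sup>2)"

definition dens :: "real \<Rightarrow> real" where
  "dens t = indicator {0..T} t * (g t)\<^sup>2"

definition \<nu> :: "real measure" where
  "\<nu> = density lborel (\<lambda>t. ennreal (dens t / m\<^sub>2))"

lemma k1: "real k - 1 \<ge> 1"
  using k by simp

lemma g_measurable [measurable]: "g \<in> borel_measurable borel"
  unfolding g_def by measurable

lemma dens_measurable [measurable]: "dens \<in> borel_measurable borel"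
  unfolding dens_def by measurable

lemma denominator_pos: "0 \<le> t \<Longrightarrow> c + (real k - 1) * t > 0"
  using c k1 by (intro add_pos_nonneg mult_nonneg_nonneg) auto

lemma g_pos: "0 \<le> t \<Longrightarrow> g t > 0"
  unfolding g_def using denominator_pos by simp

lemma continuous_g: "continuous_on {0..b} g"
  unfolding g_def using denominator_pos
  by (intro continuous_intros) (auto simp: less_imp_neq[symmetric])

lemma dens_nonneg: "dens t \<ge> 0"
  by (simp add: dens_def)

lemma m2_pos: "m\<^sub>2 > 0"
proof -
  have i: "set_integrable lborel {0..T} (\<lambda>t. (g t)\<^sup>2)"
    by (intro borel_integrable_atLeastAtMost' continuous_intros continuous_g)
  have "(g T)\<^sup>2 \<le> (g t)\<^sup>2" if "t \<in> {0..T}" for t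
  proof -
    have "g T \<le> g t"
      unfolding g_def using that denominator_pos[of t] denominator_pos[of T] k1 T
      by (intro divide_left_mono add_left_mono mult_left_mono mult_pos_pos) auto
    then show ?thesis
      using g_pos[of T] T by (intro power_mono) auto
  qed
  then have "(LBINT t:{0..T}. (g T)\<^sup>2) \<le> m\<^sub>2"
    unfolding m\<^sub>2_def by (intro set_integral_mono i) (auto intro!: borel_integrable_atLeastAtMost')
  moreover have "(LBINT t:{0..T}. (g T)\<^sup>2) > 0"
    using T g_pos[of T] by (simp add: set_lebesgue_integral_def)
  ultimately show ?thesis by simp
qed

lemma sets_nu [simp, measurable_cong]: "sets \<nu> = sets borel"
  by (simp add: \<nu>_def)

lemma space_nu [simp]: "space \<nu> = UNIV"
  by (simp add: \<nu>_def)

lemma integrable_dens: "integrable lborel dens"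
proof -
  have "set_integrable lborel {0..T} (\<lambda>t. (g t)\<^sup>2)"
    by (intro borel_integrable_atLeastAtMost' continuous_intros continuous_g)
  then show ?thesis
    by (simp add: set_integrable_def dens_def[abs_def])
qed

lemma integral_dens: "(\<integral>t. dens t \<partial>lborel) = m\<^sub>2"
  by (simp add: m\<^sub>2_def set_lebesgue_integral_def dens_def)

lemma nn_integral_dens: "(\<integral>\<^sup>+t. ennreal (dens t) \<partial>lborel) = ennreal m\<^sub>2"
  using integrable_dens by (subst nn_integral_eq_integral) (auto simp: integral_dens dens_nonneg)

sublocale prob_space \<nu>
proof
  have "emeasure \<nu> (space \<nu>) = (\<integral>\<^sup>+t. ennreal (1 / m\<^sub>2) * ennreal (dens t) \<partial>lborel)"
    unfolding \<nu>_def using m2_pos dens_nonneg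
    by (subst emeasure_density) (auto simp: ennreal_mult[symmetric])
  also have "\<dots> = ennreal (1 / m\<^sub>2) * ennreal m\<^sub>2"
    by (subst nn_integral_cmult) (auto simp: nn_integral_dens)
  also have "\<dots> = 1"
    using m2_pos by (simp add: ennreal_mult[symmetric])
  finally show "emeasure \<nu> (space \<nu>) = 1" .
qed

lemma integral_nu:
  fixes f :: "real \<Rightarrow> real"
  assumes [measurable]: "f \<in> borel_measurable borel"
  shows "(\<integral>t. f t \<partial>\<nu>) = 1 / m\<^sub>2 * (LBINT t:{0..T}. f t * (g t)\<^sup>2)"
proof -
  have "(\<integral>t. f t \<partial>\<nu>) = (\<integral>t. 1 / m\<^sub>2 * (indicator {0..T} t * (f t * (g t)\<^sup>2)) \<partial>lborel)"
    unfolding \<nu>_def using m2_pos dens_nonneg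
    by (subst integral_density) (auto simp: dens_def mult_ac)
  then show ?thesis
    by (simp add: set_lebesgue_integral_def)
qed

lemma scaled_integral_nu:
  fixes f :: "real \<Rightarrow> real"
  assumes "f \<in> borel_measurable borel"
  shows "m\<^sub>2 * (\<integral>t. f t \<partial>\<nu>) = (LBINT t:{0..T}. f t * (g t)\<^sup>2)"
  using m2_pos integral_nu[OF assms] by simp

text \<open>Strict positivity matters: it keeps \<open>r - S + k t_i\<close> positive up to and
  including \<open>S = r\<close>, where only the summand \<open>k t_i\<close> is left.\<close>

lemma AE_nu: "AE t in \<nu>. 0 < t \<and> t \<le> T"
proof -
  have "AE t in lborel. t \<noteq> (0::real)"
    by (rule AE_lborel_singleton)
  then show ?thesis
    unfolding \<nu>_def by (subst AE_density) (auto simp: dens_def elim!: eventually_mono split: split_indicator_asm)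
qed

lemma integrable_nu_bounded:
  fixes f :: "real \<Rightarrow> real"
  assumes [measurable]: "f \<in> borel_measurable borel" and "\<And>t. 0 < t \<Longrightarrow> t \<le> T \<Longrightarrow> \<bar>f t\<bar> \<le> B"
  shows "integrable \<nu> f"
proof (rule integrable_const_bound[where B=B])
  show "AE t in \<nu>. norm (f t) \<le> B"
    using AE_nu by (rule eventually_mono) (auto simp: assms(2))
qed simp

lemma integrable_nu_id: "integrable \<nu> (\<lambda>t. t)"
  by (rule integrable_nu_bounded[where B=T]) auto

lemma integrable_nu_square: "integrable \<nu> (\<lambda>t. t\<^sup>2)"
  by (rule integrable_nu_bounded[where B="T\<^sup>2"]) (auto intro!: power_mono)

section \<open>Mean and variance of one coordinate\<close>

definition \<mu> :: real where "\<mu> = (\<integral>t. t \<partial>\<nu>)"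
definition \<sigma>sq :: real where "\<sigma>sq = (\<integral>t. t\<^sup>2 \<partial>\<nu>) - \<mu>\<^sup>2"

lemma second_moment: "integrable \<nu> (\<lambda>t. (b - t)\<^sup>2)" "(\<integral>t. (b - t)\<^sup>2 \<partial>\<nu>) = (b - \<mu>)\<^sup>2 + \<sigma>sq"
proof -
  show "integrable \<nu> (\<lambda>t. (b - t)\<^sup>2)"
    unfolding power2_diff using integrable_nu_square integrable_nu_id by auto
  show "(\<integral>t. (b - t)\<^sup>2 \<partial>\<nu>) = (b - \<mu>)\<^sup>2 + \<sigma>sq"
    unfolding power2_diff using integrable_nu_square integrable_nu_id
    by (simp add: \<sigma>sq_def \<mu>_def prob_space[simplified])
qed

lemma \<sigma>sq_nonneg: "\<sigma>sq \<ge> 0"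
proof -
  have "(\<integral>t. (\<mu> - t)\<^sup>2 \<partial>\<nu>) \<ge> 0" by (intro integral_nonneg_AE) auto
  then show ?thesis by (simp add: second_moment)
qed

section \<open>Independent coordinates and the second moment of their sum\<close>

sublocale prod: product_prob_space "\<lambda>_::nat. \<nu>" I for I
  by standard

abbreviation P :: "nat set \<Rightarrow> (nat \<Rightarrow> real) measure" where
  "P A \<equiv> PiM A (\<lambda>_. \<nu>)"

lemma prob_space_P: "prob_space (P A)"
  by (intro prob_space_PiM) unfold_locales

lemma AE_P: assumes "finite A" shows "AE t in P A. \<forall>i\<in>A. 0 < t i \<and> t i \<le> T"
  using assms AE_nu by (intro AE_finite_allI AE_PiM_component) (auto intro: prob_space_axioms)

lemma distr_P_component: "i \<in> A \<Longrightarrow> distr (P A) \<nu> (\<lambda>t. t i) = \<nu>"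
  by (rule distr_PiM_component) (auto intro: prob_space_axioms)

lemma integrable_P_component:
  fixes f :: "real \<Rightarrow> real"
  assumes "i \<in> A" "integrable \<nu> f"
  shows "integrable (P A) (\<lambda>t. f (t i))" "(\<integral>t. f (t i) \<partial>P A) = (\<integral>t. f t \<partial>\<nu>)"
proof -
  have f: "f \<in> borel_measurable \<nu>" using assms by auto
  have m: "(\<lambda>t. t i) \<in> P A \<rightarrow>\<^sub>M \<nu>" using assms(1) by (rule measurable_component_singleton)
  show "integrable (P A) (\<lambda>t. f (t i))"
    using integrable_distr_eq[OF m f] assms by (simp add: distr_P_component)
  show "(\<integral>t. f (t i) \<partial>P A) = (\<integral>t. f t \<partial>\<nu>)"
    using integral_distr[OF m f] assms by (simp add: distr_P_component)
qed

lemma nn_integral_P_component: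
  assumes "i \<in> A" "f \<in> borel_measurable borel"
  shows "(\<integral>\<^sup>+t. f (t i) \<partial>P A) = (\<integral>\<^sup>+t. f t \<partial>\<nu>)"
proof -
  have m: "(\<lambda>t. t i) \<in> P A \<rightarrow>\<^sub>M \<nu>" using assms(1) by (rule measurable_component_singleton)
  show ?thesis
    using nn_integral_distr[OF m, of f] assms by (simp add: distr_P_component)
qed

text \<open>Squared bias plus variance. Integrating out one coordinate at a time turns it into a
  shift of \<open>b\<close>, so \<open>b\<close> is generalised in the induction and no covariances
  occur. The extended non-negative form composes with the later estimates without integrability
  conditions.\<close>

lemma nn_integral_sum_squares:
  assumes "finite A"
  shows "(\<integral>\<^sup>+t. ennreal ((b - (\<Sum>j\<in>A. t j))\<^sup>2) \<partial>P A) = ennreal ((b - real (card A) * \<mu>)\<^sup>2 + real (card A) * \<sigma>sq)"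
  using assms
proof (induction A arbitrary: b)
  case empty
  show ?case using prob_space.emeasure_space_1[OF prob_space_P] by simp
next
  case (insert i A)
  let ?s = "\<lambda>y. (b - y - real (card A) * \<mu>)\<^sup>2 + real (card A) * \<sigma>sq"
  have "(\<integral>\<^sup>+t. ennreal ((b - (\<Sum>j\<in>insert i A. t j))\<^sup>2) \<partial>P (insert i A))
    = (\<integral>\<^sup>+y. \<integral>\<^sup>+t. ennreal ((b - (\<Sum>j\<in>insert i A. (t(i := y)) j))\<^sup>2) \<partial>P A \<partial>\<nu>)"
    using insert by (intro prod.product_nn_integral_insert_rev) auto
  also have "\<dots> = (\<integral>\<^sup>+y. ennreal (?s y) \<partial>\<nu>)"
  proof (intro nn_integral_cong)
    fix y
    have "(\<Sum>j\<in>A. if j = i then y else t j) = (\<Sum>j\<in>A. t j)" for t :: "nat \<Rightarrow> real"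
      using insert by (intro sum.cong) auto
    then have "(\<integral>\<^sup>+t. ennreal ((b - (\<Sum>j\<in>insert i A. (t(i := y)) j))\<^sup>2) \<partial>P A)
       = (\<integral>\<^sup>+t. ennreal ((b - y - (\<Sum>j\<in>A. t j))\<^sup>2) \<partial>P A)"
      using insert by (simp add: diff_diff_eq)
    then show "(\<integral>\<^sup>+t. ennreal ((b - (\<Sum>j\<in>insert i A. (t(i := y)) j))\<^sup>2) \<partial>P A) = ennreal (?s y)"
      using insert by simp
  qed
  also have "\<dots> = (\<integral>\<^sup>+y. ennreal (((b - real (card A) * \<mu>) - y)\<^sup>2 + real (card A) * \<sigma>sq) \<partial>\<nu>)"
    by (simp add: algebra_simps)
  also have "\<dots> = ennreal (\<integral>y. ((b - real (card A) * \<mu>) - y)\<^sup>2 + real (card A) * \<sigma>sq \<partial>\<nu>)"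
    using second_moment(1) \<sigma>sq_nonneg by (intro nn_integral_eq_integral) auto
  also have "\<dots> = ennreal ((b - real (card (insert i A)) * \<mu>)\<^sup>2 + real (card (insert i A)) * \<sigma>sq)"
  proof -
    have "(\<integral>y. ((b - real (card A) * \<mu>) - y)\<^sup>2 + real (card A) * \<sigma>sq \<partial>\<nu>)
       = (b - real (card A) * \<mu> - \<mu>)\<^sup>2 + \<sigma>sq + real (card A) * \<sigma>sq"
      using second_moment by (subst Bochner_Integration.integral_add) (auto simp: prob_space[simplified])
    also have "\<dots> = (b - real (card (insert i A)) * \<mu>)\<^sup>2 + real (card (insert i A)) * \<sigma>sq"
      using insert by (simp add: algebra_simps)
    finally show ?thesis by (rule arg_cong)
  qed
  finally show ?case .
qed

end

section \<open>The Cauchy--Schwarz defect\<close>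

text \<open>Used for two values of \<open>p\<close>: \<open>p = c\<close> gives the closed form
  \<open>G\<close>, and \<open>p = a\<close> gives the integral of \<open>1 / w\<close> in
  Cauchy--Schwarz.\<close>

lemma integral_reciprocal_affine:
  fixes p q b :: real
  assumes p: "p > 0" and q: "q > 0" and b: "b \<ge> 0"
  shows "(LBINT t:{0..b}. 1 / (p + q * t)) = ln ((p + q * b) / p) / q"
    "set_integrable lborel {0..b} (\<lambda>t. 1 / (p + q * t))"
proof -
  have pos: "p + q * t > 0" if "0 \<le> t" for t
    using p q that by (intro add_pos_nonneg mult_nonneg_nonneg) auto
  have "has_bochner_integral lborel (\<lambda>t. 1 / (p + q * t) * indicator {0..b} t)
      (ln (p + q * b) / q - ln (p + q * 0) / q)"
  proof (rule has_bochner_integral_FTC_Icc_real[OF b])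
    fix t assume t: "0 \<le> t" "t \<le> b"
    then show "((\<lambda>t. ln (p + q * t) / q) has_real_derivative 1 / (p + q * t)) (at t)"
      using pos[of t] q by (auto intro!: derivative_eq_intros)
    show "isCont (\<lambda>t. 1 / (p + q * t)) t"
      using pos[of t] t by (intro continuous_intros) auto
  qed
  moreover have "ln (p + q * b) / q - ln (p + q * 0) / q = ln ((p + q * b) / p) / q"
    using p pos[of b] b by (simp add: ln_div diff_divide_distrib)
  ultimately have *: "has_bochner_integral lborel (\<lambda>t. 1 / (p + q * t) * indicator {0..b} t)
      (ln ((p + q * b) / p) / q)"
    by simp
  show "(LBINT t:{0..b}. 1 / (p + q * t)) = ln ((p + q * b) / p) / q"
    using has_bochner_integral_integral_eq[OF *] by (simp add: set_lebesgue_integral_def mult.commute)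
  show "set_integrable lborel {0..b} (\<lambda>t. 1 / (p + q * t))"
    using * by (simp add: has_bochner_integral_iff set_integrable_def mult.commute)
qed

context weight begin

definition excess :: "real \<Rightarrow> real" where
  "excess a = ln (max 1 (a / T))"

text \<open>The closed form of \<open>\<integral>\<^sub>0\<^bsup>min a T\<^esup> g\<close>, vanishing for \<open>a \<le> 0\<close>.\<close>
definition G :: "real \<Rightarrow> real" where
  "G a = ln (1 + (real k - 1) * max 0 (min a T) / c) / (real k - 1)"

lemma excess_measurable [measurable]: "excess \<in> borel_measurable borel"
  unfolding excess_def by measurable

lemma G_measurable [measurable]: "G \<in> borel_measurable borel"
  unfolding G_def by measurable

lemma excess_nonneg: "excess a \<ge> 0"
  by (simp add: excess_def)

lemma G_nonpos_arg: "a \<le> 0 \<Longrightarrow> G a = 0"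
  using T by (simp add: G_def)

lemma integral_g: "(LBINT t:{0..max 0 (min a T)}. g t) = G a"
proof -
  have "(c + (real k - 1) * max 0 (min a T)) / c = 1 + (real k - 1) * max 0 (min a T) / c"
    using c by (simp add: field_simps)
  then show ?thesis
    unfolding g_def G_def using integral_reciprocal_affine(1)[of c "real k - 1" "max 0 (min a T)"] c k1 by simp
qed

text \<open>\<open>L / (k - 1)\<close> is the integral of \<open>1 / w\<close> over
  \<open>[0, min a T]\<close>, and for \<open>a \<le> T\<close> it is exactly
  \<open>ln k / (k - 1)\<close>. For \<open>a > T\<close> the truncation shortens the integral;
  multiplying the arguments of the logarithms \<open>L\<close> and \<open>excess a\<close> gives
  \<open>a / T + k - 1\<close>, which is at least \<open>k\<close>.\<close>

lemma log_defect:
  assumes a: "a > 0"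
  defines "L \<equiv> ln ((a + (real k - 1) * min a T) / a)"
  shows "0 \<le> L" "L \<le> ln (real k)" "ln (real k) - L \<le> excess a"
proof -
  have k0: "real k \<ge> 2" using k by simp
  have ge: "(real k - 1) * min a T \<ge> 0" using k1 a T by (intro mult_nonneg_nonneg) auto
  show "0 \<le> L" unfolding L_def using a ge by (intro ln_ge_zero) (auto simp: field_simps)
  have "(real k - 1) * min a T \<le> (real k - 1) * a" using k1 by (intro mult_left_mono) auto
  then have "(a + (real k - 1) * min a T) / a \<le> real k" using a by (simp add: field_simps)
  then show "L \<le> ln (real k)"
    unfolding L_def using a ge k0 by (subst ln_le_cancel_iff) (auto intro!: divide_pos_pos add_pos_nonneg)
  show "ln (real k) - L \<le> excess a"
  proof (cases "a \<le> T")
    case True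
    have "(a + (real k - 1) * a) / a = real k" using a by (simp add: field_simps)
    then show ?thesis using True excess_nonneg by (simp add: L_def min_absorb1)
  next
    case False
    have "L = ln ((a + (real k - 1) * T) / a)" "excess a = ln (a / T)"
      unfolding L_def excess_def using False T by (auto simp: max_def min_absorb2 field_simps)
    moreover have "(a + (real k - 1) * T) / a > 0" "a / T > 0"
      using False a T k1 ge by (auto intro!: divide_pos_pos add_pos_nonneg simp: min_absorb2)
    ultimately have "L + excess a = ln ((a + (real k - 1) * T) / a * (a / T))"
      by (subst ln_mult) auto
    also have "(a + (real k - 1) * T) / a * (a / T) = a / T + real k - 1"
      using a T by (simp add: field_simps)
    also have "ln (real k) \<le> ln (a / T + real k - 1)"
    proof -
      have "a / T \<ge> 1" using False T by simp
      then show ?thesis using k0 by (subst ln_le_cancel_iff) auto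
    qed
    finally show ?thesis by simp
  qed
qed

text \<open>Cauchy--Schwarz read backwards. Its defect comes from integrating
  \<open>(w g - 1)^2 / w\<close>, and since \<open>w - 1 / g = a - c\<close> does not depend on
  \<open>t\<close>, this integrand is \<open>(a - c)^2 g^2 / w\<close>. Expanding the square
  therefore expresses \<open>Q\<close> exactly through \<open>R\<close>, \<open>G a\<close> and
  \<open>L\<close>.\<close>

lemma cauchy_schwarz_defect:
  assumes a: "a > 0"
  defines "w \<equiv> \<lambda>t. a + (real k - 1) * t"
  defines "R \<equiv> (\<integral>t. indicator {..a} t * w t \<partial>\<nu>)"
    and "Q \<equiv> (\<integral>t. indicator {..a} t * ((a - c)\<^sup>2 / w t) \<partial>\<nu>)"
  shows "ln (real k) * R \<le> (real k - 1) / m\<^sub>2 * (G a)\<^sup>2 + excess a * R + ln (real k) * Q"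
proof -
  define b where "b = min a T"
  define L where "L = ln ((a + (real k - 1) * b) / a)"
  have b: "b > 0" "max 0 (min a T) = b" using a T by (auto simp: b_def)
  have wpos: "w t > 0" if "0 \<le> t" for t
    unfolding w_def using a k1 that by (intro add_pos_nonneg mult_nonneg_nonneg) auto
  have cw: "continuous_on {0..b} w" unfolding w_def by (intro continuous_intros)
  have cut: "indicat_real {0..T} t * (indicat_real {..a} t * f t * (g t)\<^sup>2) = indicat_real {0..b} t * (f t * (g t)\<^sup>2)"
    for f :: "real \<Rightarrow> real" and t
    by (auto simp: b_def split: split_indicator)
  have wm [measurable]: "w \<in> borel_measurable borel" unfolding w_def by measurable
  have R: "m\<^sub>2 * R = (LBINT t:{0..b}. w t * (g t)\<^sup>2)"
    unfolding R_def by (subst scaled_integral_nu) (measurable, simp only: set_lebesgue_integral_def real_scaleR_def cut)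
  have Q: "m\<^sub>2 * Q = (LBINT t:{0..b}. (a - c)\<^sup>2 / w t * (g t)\<^sup>2)"
    unfolding Q_def by (subst scaled_integral_nu) (measurable, simp only: set_lebesgue_integral_def real_scaleR_def cut[of _ "\<lambda>t. (a - c)\<^sup>2 / w t"])
  have id: "(x - d)\<^sup>2 / x * (1 / d)\<^sup>2 = x * (1 / d)\<^sup>2 - 2 * (1 / d) + 1 / x" if "d > 0" "x > 0" for x d :: real
    using that by (simp add: field_simps power2_eq_square)
  have intR: "set_integrable lborel {0..b} (\<lambda>t. w t * (g t)\<^sup>2)"
    by (intro borel_integrable_atLeastAtMost' continuous_intros cw continuous_g)
  have intg: "set_integrable lborel {0..b} g"
    by (intro borel_integrable_atLeastAtMost' continuous_g)
  have intw: "set_integrable lborel {0..b} (\<lambda>t. 1 / w t)" "(LBINT t:{0..b}. 1 / w t) = L / (real k - 1)"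
    using integral_reciprocal_affine[of a "real k - 1" b] a b k1 by (auto simp: w_def L_def)
  have "(LBINT t:{0..b}. (a - c)\<^sup>2 / w t * (g t)\<^sup>2) = (LBINT t:{0..b}. w t * (g t)\<^sup>2 - 2 * g t + 1 / w t)"
  proof (intro set_lebesgue_integral_cong)
    show "\<forall>t. t \<in> {0..b} \<longrightarrow> (a - c)\<^sup>2 / w t * (g t)\<^sup>2 = w t * (g t)\<^sup>2 - 2 * g t + 1 / w t"
    proof (intro allI impI)
      fix t assume t: "t \<in> {0..b}"
      have d: "c + (real k - 1) * t > 0" using denominator_pos t by simp
      have e: "a - c = w t - (c + (real k - 1) * t)" by (simp add: w_def)
      show "(a - c)\<^sup>2 / w t * (g t)\<^sup>2 = w t * (g t)\<^sup>2 - 2 * g t + 1 / w t"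
        unfolding e g_def using d wpos[of t] t by (intro id) auto
    qed
  qed auto
  also have "\<dots> = m\<^sub>2 * R - 2 * G a + L / (real k - 1)"
    using intR intg intw integral_g[of a] b R by (simp add: set_integral_add set_integral_diff)
  finally have QR: "m\<^sub>2 * Q = m\<^sub>2 * R - 2 * G a + L / (real k - 1)"
    using Q by simp
  have L: "0 \<le> L" "L \<le> ln (real k)" "ln (real k) - L \<le> excess a"
    using log_defect[OF a] by (auto simp: L_def b_def)
  \<comment> \<open>Subtracting \<open>L\<close> times the defect identity leaves a perfect square.\<close>
  have sq: "q * x\<^sup>2 + L * (y - 2 * x + L / q) - L * y = q * (x - L / q)\<^sup>2" if "q > 0" for q x y
    using that by (simp add: field_simps power2_eq_square)
  have "(real k - 1) * (G a)\<^sup>2 + L * (m\<^sub>2 * Q) - L * (m\<^sub>2 * R) = (real k - 1) * (G a - L / (real k - 1))\<^sup>2"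
    unfolding QR using k1 by (intro sq) auto
  also have "\<dots> \<ge> 0" using k1 by simp
  finally have "L * (m\<^sub>2 * R) \<le> (real k - 1) * (G a)\<^sup>2 + L * (m\<^sub>2 * Q)" by simp
  then have "(L * R) * m\<^sub>2 \<le> (real k - 1) * (G a)\<^sup>2 + (L * Q) * m\<^sub>2" by (simp only: mult_ac)
  then have 1: "L * R \<le> (real k - 1) / m\<^sub>2 * (G a)\<^sup>2 + L * Q"
    using m2_pos by (simp add: divide_simps)
  have AE0: "AE t in \<nu>. 0 \<le> w t" using AE_nu by (rule eventually_mono) (auto intro!: less_imp_le[OF wpos])
  have "R \<ge> 0" "Q \<ge> 0"
    unfolding R_def Q_def using AE0 by (auto intro!: integral_nonneg_AE elim!: eventually_mono)
  \<comment> \<open>\<open>L\<close> is replaced by \<open>ln k\<close> on both sides: on the left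
    it falls short by at most \<open>excess a\<close>, on the right enlarging it only weakens the
    bound.\<close>
  then have "(ln (real k) - L) * R \<le> excess a * R" "L * Q \<le> ln (real k) * Q"
    using L by (auto intro!: mult_right_mono)
  with 1 show ?thesis by (simp add: algebra_simps)
qed

lemma cauchy_schwarz_defect_nn:
  fixes a :: real
  defines "w \<equiv> \<lambda>t. a + (real k - 1) * t"
  shows "(\<integral>\<^sup>+t. ennreal (indicator {..a} t * (ln (real k) * w t)) \<partial>\<nu>)
    \<le> ennreal ((real k - 1) / m\<^sub>2 * (G a)\<^sup>2)
      + (\<integral>\<^sup>+t. ennreal (indicator {..a} t * (w t * excess a + ln (real k) * ((a - c)\<^sup>2 / w t))) \<partial>\<nu>)"
proof (cases "a > 0")
  case False
  have "(\<integral>\<^sup>+t. ennreal (indicator {..a} t * (ln (real k) * w t)) \<partial>\<nu>) = (\<integral>\<^sup>+t. 0 \<partial>\<nu>)"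
    using AE_nu False by (intro nn_integral_cong_AE) (auto elim!: eventually_mono split: split_indicator)
  then show ?thesis by simp
next
  case True
  have lnk: "ln (real k) \<ge> 0" using k by simp
  have wb: "a \<le> w t \<and> w t \<le> real k * a" if "0 < t" "t \<le> a" for t
    unfolding w_def using that k1 mult_left_mono[of t a "real k - 1"]
    by (auto simp: algebra_simps)
  have iR: "integrable \<nu> (\<lambda>t. indicator {..a} t * w t)"
    using wb True by (intro integrable_nu_bounded[where B="real k * a"])
      (auto simp: w_def split: split_indicator) 
  have iQ: "integrable \<nu> (\<lambda>t. indicator {..a} t * ((a - c)\<^sup>2 / w t))"
  proof (intro integrable_nu_bounded[where B="(a - c)\<^sup>2 / a"])
    fix t assume t: "0 < t" "t \<le> T"
    show "\<bar>indicator {..a} t * ((a - c)\<^sup>2 / w t)\<bar> \<le> (a - c)\<^sup>2 / a"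
    proof (cases "t \<le> a")
      case True
      with wb[of t] t \<open>a > 0\<close> show ?thesis by (auto intro!: divide_left_mono mult_pos_pos)
    qed (use \<open>a > 0\<close> in auto)
  qed (simp add: w_def)
  have nn: "AE t in \<nu>. 0 \<le> indicator {..a} t * w t \<and> 0 \<le> indicator {..a} t * ((a - c)\<^sup>2 / w t)"
    using AE_nu by (rule eventually_mono) (use wb True in \<open>force split: split_indicator\<close>)
  let ?R = "\<integral>t. indicator {..a} t * w t \<partial>\<nu>" and ?Q = "\<integral>t. indicator {..a} t * ((a - c)\<^sup>2 / w t) \<partial>\<nu>"
  have "(\<integral>\<^sup>+t. ennreal (indicator {..a} t * (ln (real k) * w t)) \<partial>\<nu>)
     = ennreal (\<integral>t. ln (real k) * (indicator {..a} t * w t) \<partial>\<nu>)"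
    unfolding mult.left_commute[of "indicator _ _"] using iR nn lnk
    by (intro nn_integral_eq_integral) (auto elim!: eventually_mono simp del: mult_eq_0_iff)
  also have "\<dots> = ennreal (ln (real k) * ?R)" using iR by simp
  also have "\<dots> \<le> ennreal ((real k - 1) / m\<^sub>2 * (G a)\<^sup>2 + (excess a * ?R + ln (real k) * ?Q))"
    using cauchy_schwarz_defect[OF True] by (intro ennreal_leI) (simp add: w_def add.assoc)
  also have "\<dots> = ennreal ((real k - 1) / m\<^sub>2 * (G a)\<^sup>2) + ennreal (excess a * ?R + ln (real k) * ?Q)"
    using k1 m2_pos nn lnk excess_nonneg
    by (intro ennreal_plus add_nonneg_nonneg mult_nonneg_nonneg integral_nonneg_AE) (auto elim!: eventually_mono)
  also have "excess a * ?R + ln (real k) * ?Q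
      = (\<integral>t. excess a * (indicator {..a} t * w t) + ln (real k) * (indicator {..a} t * ((a - c)\<^sup>2 / w t)) \<partial>\<nu>)"
    using iR iQ by (simp del: times_divide_eq_right)
  also have "ennreal \<dots> = (\<integral>\<^sup>+t. ennreal (excess a * (indicator {..a} t * w t) + ln (real k) * (indicator {..a} t * ((a - c)\<^sup>2 / w t))) \<partial>\<nu>)"
  proof (intro nn_integral_eq_integral[symmetric])
    show "AE t in \<nu>. 0 \<le> excess a * (indicator {..a} t * w t) + ln (real k) * (indicator {..a} t * ((a - c)\<^sup>2 / w t))"
      using nn by (rule eventually_mono) (elim conjE, intro add_nonneg_nonneg mult_nonneg_nonneg[OF excess_nonneg] mult_nonneg_nonneg[OF lnk])
  qed (use iR iQ in \<open>intro Bochner_Integration.integrable_add integrable_mult_right\<close>)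
  also have "\<dots> = (\<integral>\<^sup>+t. ennreal (indicator {..a} t * (w t * excess a + ln (real k) * ((a - c)\<^sup>2 / w t))) \<partial>\<nu>)"
    by (simp add: algebra_simps)
  finally show ?thesis .
qed

end

section \<open>The rescaled test functions\<close>

lemma nn_integral_half_line:
  assumes "f \<in> borel_measurable borel"
  shows "(\<integral>\<^sup>+s. f s \<partial>half_line) = (\<integral>\<^sup>+s. f s * indicator {0..} s \<partial>lborel)"
  unfolding half_line_def by (subst nn_integral_restrict_space) auto

lemma integral_half_line:
  fixes f :: "real \<Rightarrow> real"
  shows "(\<integral>s. f s \<partial>half_line) = (\<integral>s. indicator {0..} s * f s \<partial>lborel)"
  unfolding half_line_def by (subst integral_restrict_space) auto

lemma space_half_line [simp]: "space half_line = {0..}"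
  by (simp add: half_line_def space_restrict_space)

lemma measurable_half_line: "f \<in> borel_measurable borel \<Longrightarrow> f \<in> borel_measurable half_line"
  unfolding half_line_def by (intro measurable_restrict_space1) auto

lemma space_orthant: "space (orthant A) = A \<rightarrow>\<^sub>E {0..}"
  by (simp add: orthant_def space_PiM)

lemma measurable_orthant_component [measurable (raw)]:
  "i \<in> A \<Longrightarrow> (\<lambda>t. t i) \<in> borel_measurable (orthant A)"
  unfolding orthant_def
  by (rule measurable_compose[OF measurable_component_singleton[where M="\<lambda>_. half_line"] measurable_half_line]) auto

lemma sigma_finite_half_line: "sigma_finite_measure half_line"
  unfolding half_line_def by (intro sigma_finite_measure_restrict_space) (auto intro: sigma_finite_lborel)

interpretation half_lines: product_sigma_finite "\<lambda>_::nat. half_line"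
  by (rule product_sigma_finite.intro) (rule sigma_finite_half_line)

lemma lessThan_split: "i < (k::nat) \<Longrightarrow> insert i ({..<k} - {i}) = {..<k}"
  by auto

context weight begin

definition h :: "real \<Rightarrow> real" where
  "h t = indicator {0..T} t * g t"

definition test_function :: "real \<Rightarrow> (nat \<Rightarrow> real) \<Rightarrow> real" where
  "test_function r t = (\<Prod>i<k. h (r * t i)) * (if (\<Sum>i<k. t i) \<le> 1 then 1 else 0)"

definition cdf_sum :: "real \<Rightarrow> real" where
  "cdf_sum r = measure (P {..<k}) {t \<in> space (P {..<k}). (\<Sum>i<k. t i) \<le> r}"

lemma h_measurable [measurable]: "h \<in> borel_measurable borel"
  unfolding h_def by measurable

lemma h_square: "(h t)\<^sup>2 = dens t"
  by (simp add: h_def dens_def split: split_indicator)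

lemma nn_integral_nu_rescale:
  assumes r: "r > 0" and [measurable]: "u \<in> borel_measurable borel"
  shows "(\<integral>\<^sup>+s. ennreal (r / m\<^sub>2 * dens (r * s)) * u (r * s) \<partial>half_line) = (\<integral>\<^sup>+s. u s \<partial>\<nu>)"
proof -
  have "(\<integral>\<^sup>+s. u s \<partial>\<nu>) = (\<integral>\<^sup>+s. ennreal (dens s / m\<^sub>2) * u s \<partial>lborel)"
    unfolding \<nu>_def by (subst nn_integral_density) auto
  also have "\<dots> = ennreal r * (\<integral>\<^sup>+s. ennreal (dens (r * s) / m\<^sub>2) * u (r * s) \<partial>lborel)"
    using r by (subst nn_integral_real_affine[where c=r and t=0]) auto
  also have "\<dots> = (\<integral>\<^sup>+s. ennreal (r / m\<^sub>2 * dens (r * s)) * u (r * s) \<partial>lborel)"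
    using r dens_nonneg m2_pos
    by (subst nn_integral_cmult[symmetric]) (auto simp: mult.assoc[symmetric] ennreal_mult[symmetric])
  also have "\<dots> = (\<integral>\<^sup>+s. ennreal (r / m\<^sub>2 * dens (r * s)) * u (r * s) * indicator {0..} s \<partial>lborel)"
  proof (intro nn_integral_cong)
    fix s
    have "dens (r * s) = 0" if "s < 0"
      using r mult_pos_neg[OF r that] by (simp add: dens_def)
    then show "ennreal (r / m\<^sub>2 * dens (r * s)) * u (r * s) = ennreal (r / m\<^sub>2 * dens (r * s)) * u (r * s) * indicator {0..} s"
      by (cases "s < 0") (auto split: split_indicator)
  qed
  also have "\<dots> = (\<integral>\<^sup>+s. ennreal (r / m\<^sub>2 * dens (r * s)) * u (r * s) \<partial>half_line)"
    by (subst nn_integral_half_line) auto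
  finally show ?thesis by simp
qed

section \<open>Orthant integrals as expectations\<close>

lemma measurable_dilation [measurable]: "(\<lambda>t. \<lambda>i\<in>A. r * t i) \<in> orthant A \<rightarrow>\<^sub>M P A"
  by (intro measurable_restrict) (simp add: measurable_cong_sets[OF refl sets_nu])

text \<open>Each factor \<open>r / m\<^sub>2\<close> combines the Jacobian of the dilation with the
  normalisation of \<open>\<nu>\<close>. Product measures are determined by boxes, where the
  integral factorises; restricting to \<open>A\<close> makes the dilated point extensional, as
  membership in \<open>Pi\<^sub>E A B\<close> requires.\<close>

lemma distr_dilation:
  assumes r: "r > 0" and A: "finite A"
  shows "distr (density (orthant A) (\<lambda>t. \<Prod>i\<in>A. ennreal (r / m\<^sub>2 * dens (r * t i)))) (P A) (\<lambda>t. \<lambda>i\<in>A. r * t i) = P A"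
    (is "distr ?D _ ?\<phi> = _")
proof (rule prod.PiM_eqI[OF A])
  fix B :: "nat \<Rightarrow> real set"
  assume B: "\<And>i. i \<in> A \<Longrightarrow> B i \<in> sets \<nu>"
  have PB: "Pi\<^sub>E A B \<in> sets (P A)" using A B by (intro sets_PiM_I_finite) auto
  have "emeasure (distr ?D (P A) ?\<phi>) (Pi\<^sub>E A B) = (\<integral>\<^sup>+t. indicator (Pi\<^sub>E A B) t \<partial>distr ?D (P A) ?\<phi>)"
    using PB by simp
  also have "\<dots> = (\<integral>\<^sup>+t. (\<Prod>i\<in>A. ennreal (r / m\<^sub>2 * dens (r * t i))) * indicator (Pi\<^sub>E A B) (?\<phi> t) \<partial>orthant A)"
    using PB by (subst nn_integral_distr) (auto simp: nn_integral_density)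
  also have "\<dots> = (\<integral>\<^sup>+t. (\<Prod>i\<in>A. ennreal (r / m\<^sub>2 * dens (r * t i)) * indicator (B i) (r * t i)) \<partial>orthant A)"
  proof (intro nn_integral_cong)
    fix t :: "nat \<Rightarrow> real"
    have "indicator (Pi\<^sub>E A B) (?\<phi> t) = (\<Prod>i\<in>A. indicator (B i) (r * t i) :: ennreal)"
      using A by (auto simp: indicator_def PiE_iff prod_zero_iff intro!: prod.neutral[symmetric])
    then show "(\<Prod>i\<in>A. ennreal (r / m\<^sub>2 * dens (r * t i))) * indicator (Pi\<^sub>E A B) (?\<phi> t)
        = (\<Prod>i\<in>A. ennreal (r / m\<^sub>2 * dens (r * t i)) * indicator (B i) (r * t i))"
      by (simp add: prod.distrib)
  qed
  also have "\<dots> = (\<Prod>i\<in>A. \<integral>\<^sup>+s. ennreal (r / m\<^sub>2 * dens (r * s)) * indicator (B i) (r * s) \<partial>half_line)"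
    unfolding orthant_def using A B
    by (intro half_lines.product_nn_integral_prod) (auto intro!: measurable_half_line)
  also have "\<dots> = (\<Prod>i\<in>A. emeasure \<nu> (B i))"
    using B by (intro prod.cong refl) (subst nn_integral_nu_rescale[OF r], auto)
  finally show "emeasure (distr ?D (P A) ?\<phi>) (Pi\<^sub>E A B) = (\<Prod>i\<in>A. emeasure \<nu> (B i))" .
qed simp

lemma nn_integral_dilation:
  assumes r: "r > 0" and A: "finite A" and [measurable]: "f \<in> borel_measurable (P A)"
  shows "(\<integral>\<^sup>+t. ennreal (\<Prod>i\<in>A. dens (r * t i)) * f (\<lambda>i\<in>A. r * t i) \<partial>orthant A)
    = ennreal ((m\<^sub>2 / r) ^ card A) * (\<integral>\<^sup>+t. f t \<partial>P A)"
proof -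
  have 1: "(\<integral>\<^sup>+t. f t \<partial>P A) = (\<integral>\<^sup>+t. (\<Prod>i\<in>A. ennreal (r / m\<^sub>2 * dens (r * t i))) * f (\<lambda>i\<in>A. r * t i) \<partial>orthant A)"
    using r A by (subst distr_dilation[OF r A, symmetric], subst nn_integral_distr) (auto simp: nn_integral_density)
  have 2: "ennreal ((m\<^sub>2 / r) ^ card A) * (\<Prod>i\<in>A. ennreal (r / m\<^sub>2 * dens (r * t i))) = ennreal (\<Prod>i\<in>A. dens (r * t i))" for t
  proof -
    have "ennreal ((m\<^sub>2 / r) ^ card A) * (\<Prod>i\<in>A. ennreal (r / m\<^sub>2 * dens (r * t i)))
      = (\<Prod>i\<in>A. ennreal (m\<^sub>2 / r) * ennreal (r / m\<^sub>2 * dens (r * t i)))"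
      using m2_pos r by (simp add: prod.distrib ennreal_power)
    also have "\<dots> = (\<Prod>i\<in>A. ennreal (dens (r * t i)))"
      using m2_pos r dens_nonneg by (intro prod.cong refl) (simp add: ennreal_mult[symmetric])
    also have "\<dots> = ennreal (\<Prod>i\<in>A. dens (r * t i))"
      using dens_nonneg by (intro prod_ennreal) auto
    finally show ?thesis .
  qed
  show ?thesis
    unfolding 1 by (subst nn_integral_cmult[symmetric]) (auto simp only: mult.assoc[symmetric] 2, measurable)
qed

lemma test_function_measurable: "test_function r \<in> borel_measurable (orthant {..<k})"
  unfolding test_function_def[abs_def] by measurable

lemma test_function_square:
  assumes r: "r > 0"
  shows "(\<integral>\<^sup>+t. ennreal ((test_function r t)\<^sup>2) \<partial>orthant {..<k}) = ennreal ((m\<^sub>2 / r) ^ k * cdf_sum r)"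
proof -
  let ?E = "{t \<in> space (P {..<k}). (\<Sum>i<k. t i) \<le> r}"
  have [measurable]: "?E \<in> sets (P {..<k})" by measurable
  have "(\<integral>\<^sup>+t. ennreal ((test_function r t)\<^sup>2) \<partial>orthant {..<k})
    = (\<integral>\<^sup>+t. ennreal (\<Prod>i<k. dens (r * t i)) * indicator ?E (\<lambda>i\<in>{..<k}. r * t i) \<partial>orthant {..<k})"
  proof (intro nn_integral_cong)
    fix t :: "nat \<Rightarrow> real"
    have "(\<Sum>i<k. r * t i) \<le> r \<longleftrightarrow> (\<Sum>i<k. t i) \<le> 1"
      using r by (simp add: sum_distrib_left[symmetric])
    then show "ennreal ((test_function r t)\<^sup>2) = ennreal (\<Prod>i<k. dens (r * t i)) * indicator ?E (\<lambda>i\<in>{..<k}. r * t i)"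
      by (auto simp: test_function_def power_mult_distrib prod_power_distrib h_square space_PiM split: split_indicator)
  qed
  also have "\<dots> = ennreal ((m\<^sub>2 / r) ^ k) * emeasure (P {..<k}) ?E"
    using r by (subst nn_integral_dilation) auto
  also have "\<dots> = ennreal ((m\<^sub>2 / r) ^ k * cdf_sum r)"
    using r m2_pos by (simp add: cdf_sum_def ennreal_mult prod.emeasure_eq_measure)
  finally show ?thesis .
qed

lemma I_int_test_function:
  assumes r: "r > 0"
  shows "I_int k (test_function r) = (m\<^sub>2 / r) ^ k * cdf_sum r"
    "integrable (orthant {..<k}) (\<lambda>t. (test_function r t)\<^sup>2)"
proof -
  note [measurable] = test_function_measurable
  have 0: "(m\<^sub>2 / r) ^ k * cdf_sum r \<ge> 0" using r m2_pos by (simp add: cdf_sum_def)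
  show "integrable (orthant {..<k}) (\<lambda>t. (test_function r t)\<^sup>2)"
    by (intro integrableI_nonneg) (auto simp: test_function_square[OF r])
  show "I_int k (test_function r) = (m\<^sub>2 / r) ^ k * cdf_sum r"
    unfolding I_int_def using 0 by (subst integral_eq_nn_integral) (auto simp: test_function_square[OF r])
qed

text \<open>No sign condition on \<open>b\<close>: for \<open>b < 0\<close> the integrand is zero
  and \<open>G\<close> vanishes as well. This is the case where the other coordinates alone already
  leave the simplex.\<close>

lemma inner_integral:
  assumes r: "r > 0"
  shows "(\<integral>s. h (r * s) * (if s \<le> b then 1 else 0) \<partial>half_line) = G (r * b) / r"
proof -
  have "(\<integral>s. h (r * s) * (if s \<le> b then 1 else 0) \<partial>half_line)
    = (\<integral>s. indicator {0..} s * (h (r * s) * (if s \<le> b then 1 else 0)) \<partial>lborel)"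
    by (rule integral_half_line)
  also have "\<dots> = (\<integral>s. h (r * s) * (if r * s \<le> r * b then 1 else 0) \<partial>lborel)"
    using r by (intro Bochner_Integration.integral_cong) (auto simp: h_def zero_le_mult_iff split: split_indicator)
  also have "\<dots> = (\<integral>s. h s * (if s \<le> r * b then 1 else 0) \<partial>lborel) / r"
    using lborel_integral_real_affine[of r "\<lambda>s. h s * (if s \<le> r * b then 1 else 0)" 0] r by simp
  also have "(\<integral>s. h s * (if s \<le> r * b then 1 else 0) \<partial>lborel) = G (r * b)"
  proof (cases "r * b < 0")
    case True
    then have "(\<integral>s. h s * (if s \<le> r * b then 1 else 0) \<partial>lborel) = (\<integral>s. 0 \<partial>(lborel :: real measure))"
      by (intro Bochner_Integration.integral_cong) (auto simp: h_def)
    then show ?thesis using True by (simp add: G_nonpos_arg)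
  next
    case False
    then show ?thesis
      using T by (subst integral_g[symmetric], unfold set_lebesgue_integral_def,
          intro Bochner_Integration.integral_cong) (auto simp: h_def split: split_indicator)
  qed
  finally show ?thesis .
qed

lemma G_bounds: "0 \<le> G a" "G a \<le> G T"
proof -
  have 0: "(real k - 1) * max 0 (min a T) / c \<ge> 0" using k1 c by simp
  then show "0 \<le> G a" unfolding G_def using k1 by simp
  have "(real k - 1) * max 0 (min a T) / c \<le> (real k - 1) * max 0 (min T T) / c"
    using k1 c T by (intro divide_right_mono mult_left_mono) auto
  with 0 show "G a \<le> G T"
    unfolding G_def using k1 by (intro divide_right_mono) (auto simp: add_pos_nonneg)
qed

lemma integrable_G_square:
  "integrable (P A) (\<lambda>t. (G (r - (\<Sum>j\<in>A. t j)))\<^sup>2)"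
  by (rule prod.integrable_const_bound[where B="(G T)\<^sup>2"]) (auto intro!: power_mono G_bounds)

lemma J_int_test_function:
  assumes r: "r > 0" and i: "i < k"
  defines "A \<equiv> {..<k} - {i}"
  shows "J_int k i (test_function r)
    = (m\<^sub>2 / r) ^ (k - 1) / r\<^sup>2 * (\<integral>t. (G (r - (\<Sum>j\<in>A. t j)))\<^sup>2 \<partial>P A)"
proof -
  have A: "finite A" "i \<notin> A" "insert i A = {..<k}" "card A = k - 1"
    using i by (auto simp: A_def)
  have inner: "(\<integral>s. test_function r (t(i := s)) \<partial>half_line)
     = (\<Prod>j\<in>A. h (r * t j)) * (G (r - (\<Sum>j\<in>A. r * t j)) / r)" for t
  proof -
    have p: "(\<Prod>j<k. h (r * (t(i := s)) j)) = h (r * s) * (\<Prod>j\<in>A. h (r * t j))" for s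
    proof -
      have "(\<Prod>j\<in>A. h (r * (t(i := s)) j)) = (\<Prod>j\<in>A. h (r * t j))" using A by (intro prod.cong) auto
      then show ?thesis using A by (subst A(3)[symmetric], subst prod.insert) auto
    qed
    have q: "(\<Sum>j<k. (t(i := s)) j) = s + (\<Sum>j\<in>A. t j)" for s
    proof -
      have "(\<Sum>j\<in>A. (t(i := s)) j) = (\<Sum>j\<in>A. t j)" using A by (intro sum.cong) auto
      then show ?thesis using A by (subst A(3)[symmetric], subst sum.insert) auto
    qed
    have "(\<integral>s. test_function r (t(i := s)) \<partial>half_line)
       = (\<integral>s. (\<Prod>j\<in>A. h (r * t j)) * (h (r * s) * (if s \<le> 1 - (\<Sum>j\<in>A. t j) then 1 else 0)) \<partial>half_line)"
      unfolding test_function_def p q by (intro Bochner_Integration.integral_cong) auto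
    also have "\<dots> = (\<Prod>j\<in>A. h (r * t j)) * (G (r * (1 - (\<Sum>j\<in>A. t j))) / r)"
      by (simp only: integral_mult_right_zero inner_integral[OF r])
    finally show ?thesis by (simp add: right_diff_distrib sum_distrib_left)
  qed
  have "J_int k i (test_function r)
     = (\<integral>t. ((\<Prod>j\<in>A. h (r * t j)) * (G (r - (\<Sum>j\<in>A. r * t j)) / r))\<^sup>2 \<partial>orthant A)"
    by (simp add: J_int_def inner A_def[symmetric])
  also have "\<dots> = enn2real (\<integral>\<^sup>+t. ennreal (((\<Prod>j\<in>A. h (r * t j)) * (G (r - (\<Sum>j\<in>A. r * t j)) / r))\<^sup>2) \<partial>orthant A)"
    by (intro integral_eq_nn_integral) auto
  also have "(\<integral>\<^sup>+t. ennreal (((\<Prod>j\<in>A. h (r * t j)) * (G (r - (\<Sum>j\<in>A. r * t j)) / r))\<^sup>2) \<partial>orthant A)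
     = (\<integral>\<^sup>+t. ennreal (\<Prod>j\<in>A. dens (r * t j)) * (\<lambda>t. ennreal ((G (r - (\<Sum>j\<in>A. t j)))\<^sup>2 / r\<^sup>2)) (\<lambda>j\<in>A. r * t j) \<partial>orthant A)"
    by (simp add: power_mult_distrib power_divide prod_power_distrib h_square ennreal_mult[symmetric] dens_nonneg prod_nonneg)
  also have "\<dots> = ennreal ((m\<^sub>2 / r) ^ card A) * (\<integral>\<^sup>+t. ennreal ((G (r - (\<Sum>j\<in>A. t j)))\<^sup>2 / r\<^sup>2) \<partial>P A)"
    using r A by (intro nn_integral_dilation) auto
  also have "\<dots> = ennreal ((m\<^sub>2 / r) ^ card A) * ennreal (\<integral>t. (G (r - (\<Sum>j\<in>A. t j)))\<^sup>2 / r\<^sup>2 \<partial>P A)"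
    using integrable_G_square by (subst nn_integral_eq_integral) auto
  finally show ?thesis
    using r m2_pos A by (simp add: ennreal_mult[symmetric] integral_nonneg_AE)
qed

text \<open>The hypothesis \<open>r \<ge> 1\<close> makes the support respect the truncation, as
  \<open>h (r * t) \<noteq> 0\<close> forces \<open>t \<le> T / r \<le> T\<close>. Positivity of
  \<open>cdf_sum r\<close> is the required non-vanishing up to null sets.\<close>

lemma test_function_admissible:
  assumes r: "r \<ge> 1" and pos: "cdf_sum r > 0"
  shows "test_function r \<in> admissible k (truncated_simplex_region k T)"
  unfolding admissible_def
proof (intro CollectI conjI ballI impI)
  have r0: "r > 0" using r by simp
  show "square_integrable k (test_function r)"
    unfolding square_integrable_def using test_function_measurable I_int_test_function(2)[OF r0] by simp
  show "\<not> (AE t in orthant {..<k}. test_function r t = 0)"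
  proof
    assume "AE t in orthant {..<k}. test_function r t = 0"
    then have "(\<integral>\<^sup>+t. ennreal ((test_function r t)\<^sup>2) \<partial>orthant {..<k}) = (\<integral>\<^sup>+t. 0 \<partial>orthant {..<k})"
      by (intro nn_integral_cong_AE) (auto elim!: eventually_mono)
    then have "ennreal ((m\<^sub>2 / r) ^ k * cdf_sum r) = 0"
      using test_function_square[OF r0] by simp
    then have "(m\<^sub>2 / r) ^ k * cdf_sum r \<le> 0" by (simp only: ennreal_eq_0_iff)
    moreover have "(m\<^sub>2 / r) ^ k * cdf_sum r > 0" using pos r0 m2_pos by simp
    ultimately show False by simp
  qed
  fix t assume t: "t \<in> space (orthant {..<k})" "t \<notin> truncated_simplex_region k T"
  show "test_function r t = 0"
  proof (rule ccontr)
    assume "test_function r t \<noteq> 0"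
    then have *: "(\<Sum>i<k. t i) \<le> 1" "\<forall>i<k. h (r * t i) \<noteq> 0"
      by (auto simp: test_function_def prod_zero_iff split: if_splits)
    have "t i \<le> T" if "i < k" for i
    proof -
      have "0 \<le> t i" using t(1) that by (auto simp: space_orthant)
      moreover have "r * t i \<le> T" using *(2) that by (auto simp: h_def split: split_indicator_asm)
      ultimately show ?thesis using r mult_right_mono[of 1 r "t i"] by simp
    qed
    then have "t \<in> truncated_simplex_region k T"
      using t(1) *(1) by (auto simp: truncated_simplex_region_def space_orthant PiE_iff)
    with t(2) show False by simp
  qed
qed

text \<open>\<open>I_int\<close> carries \<open>k\<close> factors \<open>m\<^sub>2 / r\<close>,
  whereas each \<open>J_int\<close> carries \<open>k - 1\<close> of them and \<open>1 / r^2\<close>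
  from squaring the inner integral. What survives in the quotient is
  \<open>1 / (r m\<^sub>2)\<close>.\<close>

lemma M_trunc_lower_bound:
  assumes r: "r \<ge> 1" and pos: "cdf_sum r > 0"
  shows "ereal ((\<Sum>i<k. \<integral>t. (G (r - (\<Sum>j\<in>{..<k} - {i}. t j)))\<^sup>2 \<partial>P ({..<k} - {i})) / (r * m\<^sub>2 * cdf_sum r)) \<le> M_trunc k T"
proof -
  have r0: "r > 0" using r by simp
  define E where "E i = (\<integral>t. (G (r - (\<Sum>j\<in>{..<k} - {i}. t j)))\<^sup>2 \<partial>P ({..<k} - {i}))" for i
  have kk: "(m\<^sub>2 / r) ^ k = (m\<^sub>2 / r) ^ (k - 1) * (m\<^sub>2 / r)"
    using k by (simp add: power_eq_if)
  have "(\<Sum>i<k. J_int k i (test_function r)) = (\<Sum>i<k. (m\<^sub>2 / r) ^ (k - 1) / r\<^sup>2 * E i)"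
    unfolding E_def by (intro sum.cong refl J_int_test_function[OF r0]) auto
  also have "\<dots> = (m\<^sub>2 / r) ^ (k - 1) / r\<^sup>2 * (\<Sum>i<k. E i)" by (simp only: sum_distrib_left)
  finally have "(\<Sum>i<k. J_int k i (test_function r)) / I_int k (test_function r) = (\<Sum>i<k. E i) / (r * m\<^sub>2 * cdf_sum r)"
    unfolding I_int_test_function(1)[OF r0] kk using r0 m2_pos pos
    by (simp add: power2_eq_square divide_simps)
  moreover have "ereal ((\<Sum>i<k. J_int k i (test_function r)) / I_int k (test_function r)) \<le> M_trunc k T"
    unfolding M_trunc_def by (intro SUP_upper test_function_admissible r pos)
  ultimately show ?thesis by (simp add: E_def)
qed

end

section \<open>Estimates at a fixed scale\<close>

text \<open>Only a finite non-negative number changes sides, so \<open>x\<close> may be infinite. In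
  this way the contribution of the supremum moves to the left while the right side is not yet known
  to be finite.\<close>

lemma ennreal_diff_le:
  assumes "ennreal a \<le> ennreal b + x" "0 \<le> b"
  shows "ennreal (a - b) \<le> x"
proof (cases x rule: ennreal_cases)
  case (real y)
  with assms have "ennreal a \<le> ennreal (b + y)" by (simp add: ennreal_plus[symmetric] del: ennreal_plus)
  then have "a \<le> b + y" using real assms by (subst (asm) ennreal_le_iff) auto
  then show ?thesis using real by (auto intro!: ennreal_leI)
qed simp

lemma measurable_indicator_atMost [measurable (raw)]:
  fixes f g :: "'a \<Rightarrow> real"
  assumes [measurable]: "f \<in> borel_measurable M" "g \<in> borel_measurable M"
  shows "(\<lambda>x. indicat_real {..g x} (f x)) \<in> borel_measurable M"
  unfolding indicator_def atMost_iff by measurable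

context weight begin

section \<open>Conditioning on all coordinates but one\<close>

definition rest :: "nat \<Rightarrow> (nat \<Rightarrow> real) \<Rightarrow> real" where
  "rest i t = (\<Sum>j\<in>{..<k} - {i}. t j)"

lemma rest_eq: "i < k \<Longrightarrow> rest i t = (\<Sum>j<k. t j) - t i"
  unfolding rest_def by (subst sum_diff1) auto

lemma rest_measurable [measurable]: "rest i \<in> borel_measurable (P {..<k})"
  unfolding rest_def[abs_def] by measurable

lemma nn_integral_P_split:
  assumes i: "i < k" and [measurable]: "case_prod f \<in> borel_measurable (borel \<Otimes>\<^sub>M borel)"
  shows "(\<integral>\<^sup>+t. f (t i) (rest i t) \<partial>P {..<k}) = (\<integral>\<^sup>+t. \<integral>\<^sup>+y. f y (\<Sum>j\<in>{..<k} - {i}. t j) \<partial>\<nu> \<partial>P ({..<k} - {i}))"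
proof -
  let ?A = "{..<k} - {i}"
  have "(\<lambda>t. f (t i) (rest i t)) \<in> borel_measurable (P {..<k})"
  proof -
    have "i \<in> {..<k}" using i by simp
    then show ?thesis by measurable
  qed
  then have "(\<integral>\<^sup>+t. f (t i) (rest i t) \<partial>P (insert i ?A)) = (\<integral>\<^sup>+t. \<integral>\<^sup>+y. f ((t(i := y)) i) (rest i (t(i := y))) \<partial>\<nu> \<partial>P ?A)"
    by (intro prod.product_nn_integral_insert) (simp_all only: lessThan_split[OF i] finite_Diff finite_lessThan, simp)
  moreover have "rest i (t(i := y)) = (\<Sum>j\<in>?A. t j)" for t y
    unfolding rest_def by (intro sum.cong) auto
  ultimately show ?thesis by (simp only: lessThan_split[OF i] fun_upd_same)
qed

text \<open>\<open>a\<close> depends only on the other coordinates, hence is independent of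
  \<open>t i\<close>; the one-variable inequality applies after conditioning on them.\<close>

lemma nn_integral_cauchy_schwarz_defect:
  fixes r :: real
  assumes i: "i < k"
  defines "a \<equiv> \<lambda>t. r - rest i t"
  defines "w \<equiv> \<lambda>t. a t + (real k - 1) * t i"
  shows "(\<integral>\<^sup>+t. ennreal (indicator {..a t} (t i) * (ln (real k) * w t)) \<partial>P {..<k})
    \<le> ennreal ((real k - 1) / m\<^sub>2 * (\<integral>t. (G (r - (\<Sum>j\<in>{..<k} - {i}. t j)))\<^sup>2 \<partial>P ({..<k} - {i})))
      + (\<integral>\<^sup>+t. ennreal (indicator {..a t} (t i) * (w t * excess (a t) + ln (real k) * ((a t - c)\<^sup>2 / w t))) \<partial>P {..<k})"
proof -
  let ?A = "{..<k} - {i}"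
  define b where "b t = r - (\<Sum>j\<in>?A. t j)" for t :: "nat \<Rightarrow> real"
  have [measurable]: "b \<in> borel_measurable (P ?A)" unfolding b_def[abs_def] by measurable
  have "(\<integral>\<^sup>+t. ennreal (indicator {..a t} (t i) * (ln (real k) * w t)) \<partial>P {..<k})
     = (\<integral>\<^sup>+t. \<integral>\<^sup>+y. ennreal (indicator {..b t} y * (ln (real k) * (b t + (real k - 1) * y))) \<partial>\<nu> \<partial>P ?A)"
    unfolding a_def w_def b_def by (rule nn_integral_P_split[OF i]) measurable
  also have "\<dots> \<le> (\<integral>\<^sup>+t. ennreal ((real k - 1) / m\<^sub>2 * (G (b t))\<^sup>2)
      + (\<integral>\<^sup>+y. ennreal (indicator {..b t} y * ((b t + (real k - 1) * y) * excess (b t)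
           + ln (real k) * ((b t - c)\<^sup>2 / (b t + (real k - 1) * y)))) \<partial>\<nu>) \<partial>P ?A)"
    by (intro nn_integral_mono cauchy_schwarz_defect_nn)
  also have "\<dots> = (\<integral>\<^sup>+t. ennreal ((real k - 1) / m\<^sub>2 * (G (b t))\<^sup>2) \<partial>P ?A)
      + (\<integral>\<^sup>+t. \<integral>\<^sup>+y. ennreal (indicator {..b t} y * ((b t + (real k - 1) * y) * excess (b t)
           + ln (real k) * ((b t - c)\<^sup>2 / (b t + (real k - 1) * y)))) \<partial>\<nu> \<partial>P ?A)"
    by (rule nn_integral_add) measurable
  also have "(\<integral>\<^sup>+t. ennreal ((real k - 1) / m\<^sub>2 * (G (b t))\<^sup>2) \<partial>P ?A)
      = ennreal (\<integral>t. (real k - 1) / m\<^sub>2 * (G (b t))\<^sup>2 \<partial>P ?A)"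
    unfolding b_def using k1 m2_pos integrable_G_square by (intro nn_integral_eq_integral) auto
  also have "(\<integral>t. (real k - 1) / m\<^sub>2 * (G (b t))\<^sup>2 \<partial>P ?A) = (real k - 1) / m\<^sub>2 * (\<integral>t. (G (b t))\<^sup>2 \<partial>P ?A)"
    by (rule integral_mult_right_zero)
  also have "(\<integral>\<^sup>+t. \<integral>\<^sup>+y. ennreal (indicator {..b t} y * ((b t + (real k - 1) * y) * excess (b t)
           + ln (real k) * ((b t - c)\<^sup>2 / (b t + (real k - 1) * y)))) \<partial>\<nu> \<partial>P ?A)
     = (\<integral>\<^sup>+t. ennreal (indicator {..a t} (t i) * (w t * excess (a t) + ln (real k) * ((a t - c)\<^sup>2 / w t))) \<partial>P {..<k})"
    unfolding a_def w_def b_def by (rule nn_integral_P_split[OF i, symmetric]) measurable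
  finally show ?thesis unfolding b_def .
qed

text \<open>With \<open>q = x / A - 1\<close> the bound is \<open>l + q + q\<^sup>2 / (4 l) = (l + q / 2)\<^sup>2 / l\<close>; the form chosen makes its
  expectation a single second moment.\<close>
lemma excess_le_quadratic:
  assumes A: "A > T"
  defines "l \<equiv> ln (A / T)"
  shows "excess x \<le> (2 * l * A + x - A)\<^sup>2 / (4 * A\<^sup>2 * l)"
proof -
  have A0: "A > 0" using A T by simp
  have l: "l > 0" unfolding l_def using A T by (intro ln_gt_zero) simp
  have eq: "(2 * l * A + x - A)\<^sup>2 / (4 * A\<^sup>2 * l) = l + (x / A - 1) + (x / A - 1)\<^sup>2 / (4 * l)"
    using A0 l by (simp add: field_simps power2_eq_square)
  show ?thesis
  proof (cases "x \<le> T")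
    case True
    then have "excess x = 0" unfolding excess_def using T by (simp add: max_def field_simps)
    then show ?thesis using A0 l by simp
  next
    case False
    then have x: "x > 0" "x / T > 1" using T by auto
    then have "excess x = ln (x / T)" by (simp add: excess_def)
    also have "\<dots> = l + ln (x / A)" unfolding l_def using x T A0 by (simp add: ln_div)
    also have "\<dots> \<le> l + (x / A - 1)" using x A0 by (intro add_left_mono ln_le_minus_one) auto
    also have "\<dots> \<le> l + (x / A - 1) + (x / A - 1)\<^sup>2 / (4 * l)" using l by simp
    finally show ?thesis unfolding eq .
  qed
qed

text \<open>Since \<open>max 1 (x / T) \<ge> 1\<close>, adding \<open>y\<close> multiplies it by at
  most \<open>1 + y / T\<close>. With \<open>x = r - S\<close> and \<open>y = t i\<close> this
  separates the gap common to all indices from the individual coordinate.\<close>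

lemma excess_add_le:
  assumes "x \<ge> 0" "y \<ge> 0"
  shows "excess (x + y) \<le> excess x + ln (1 + y / T)"
proof -
  have y: "y / T \<ge> 0" using assms T by simp
  have "y / T \<le> max 1 (x / T) * (y / T)" using mult_right_mono[of 1 "max 1 (x / T)" "y / T"] y by simp
  then have "max 1 ((x + y) / T) \<le> max 1 (x / T) * (1 + y / T)"
  proof -
    have "1 * 1 \<le> max 1 (x / T) * (1 + y / T)" using y by (intro mult_mono) auto
    moreover have "(x + y) / T \<le> max 1 (x / T) + max 1 (x / T) * (y / T)"
      using \<open>y / T \<le> _\<close> unfolding add_divide_distrib by (intro add_mono) auto
    ultimately show ?thesis by (simp add: distrib_left)
  qed
  then have "excess (x + y) \<le> ln (max 1 (x / T) * (1 + y / T))"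
    unfolding excess_def by (subst ln_le_cancel_iff) (use y in \<open>auto intro!: mult_pos_pos\<close>)
  also have "\<dots> = excess x + ln (1 + y / T)"
    unfolding excess_def using y by (subst ln_mult) auto
  finally show ?thesis .
qed

text \<open>The common factor \<open>excess (r - S)\<close> meets the total weight
  \<open>k r\<close>. The logarithm \<open>ln (1 + t i / T)\<close> stays exact against
  \<open>k t i\<close>, which leads to \<open>z3\<close>, and is replaced by \<open>t i / T\<close>
  against \<open>r - S\<close>; the latter terms add up to \<open>(r - S) S / T\<close>, at most its
  value at \<open>S = r / 2\<close>.\<close>

lemma sum_excess_le:
  fixes t :: "nat \<Rightarrow> real"
  assumes t: "\<And>i. i < k \<Longrightarrow> 0 < t i" and S: "(\<Sum>i<k. t i) \<le> r"
  defines "a \<equiv> \<lambda>i. r - rest i t"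
  shows "(\<Sum>i<k. (a i + (real k - 1) * t i) * excess (a i))
    \<le> real k * r * excess (r - (\<Sum>i<k. t i)) + r\<^sup>2 / (4 * T) + (\<Sum>i<k. real k * t i * ln (1 + t i / T))"
proof -
  define s where "s = (\<Sum>i<k. t i)"
  have a: "a i = r - s + t i" if "i < k" for i using that by (simp add: a_def rest_eq s_def)
  have "(\<Sum>i<k. (a i + (real k - 1) * t i) * excess (a i))
    \<le> (\<Sum>i<k. (r - s + real k * t i) * excess (r - s) + (r - s) * (t i / T) + real k * t i * ln (1 + t i / T))"
  proof (intro sum_mono)
    fix i assume "i \<in> {..<k}"
    then have i: "i < k" "0 < t i" using t by auto
    have rs: "r - s \<ge> 0" using S by (simp add: s_def)
    have w: "r - s + real k * t i \<ge> 0" using rs i by simp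
    have "(a i + (real k - 1) * t i) * excess (a i) = (r - s + real k * t i) * excess (r - s + t i)"
      unfolding a[OF i(1)] by (rule arg_cong2[where f="(*)"]) (simp_all add: algebra_simps)
    also have "\<dots> \<le> (r - s + real k * t i) * (excess (r - s) + ln (1 + t i / T))"
      using w rs i by (intro mult_left_mono excess_add_le) auto
    also have "\<dots> = (r - s + real k * t i) * excess (r - s) + (r - s) * ln (1 + t i / T) + real k * t i * ln (1 + t i / T)"
      by (simp add: algebra_simps)
    also have "(r - s) * ln (1 + t i / T) \<le> (r - s) * (t i / T)"
      using rs i T by (intro mult_left_mono ln_add_one_self_le_self) auto
    finally show "(a i + (real k - 1) * t i) * excess (a i)
       \<le> (r - s + real k * t i) * excess (r - s) + (r - s) * (t i / T) + real k * t i * ln (1 + t i / T)" by simp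
  qed
  also have "\<dots> = (\<Sum>i<k. r - s + real k * t i) * excess (r - s) + (r - s) * (s / T) + (\<Sum>i<k. real k * t i * ln (1 + t i / T))"
    by (simp only: sum.distrib sum_distrib_left[symmetric] sum_distrib_right[symmetric] sum_divide_distrib[symmetric] s_def)
  also have "(\<Sum>i<k. r - s + real k * t i) = real k * r"
    by (simp add: sum.distrib sum_subtractf sum_distrib_left[symmetric] s_def algebra_simps)
  also have "(r - s) * (s / T) \<le> r\<^sup>2 / (4 * T)"
  proof -
    have "0 \<le> (r - 2 * s)\<^sup>2" by simp
    then have "4 * ((r - s) * s) \<le> r\<^sup>2" by (simp add: power2_eq_square algebra_simps)
    then have "4 * ((r - s) * s) / (4 * T) \<le> r\<^sup>2 / (4 * T)" using T by (intro divide_right_mono) auto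
    then show ?thesis by simp
  qed
  finally show ?thesis unfolding s_def by simp
qed

text \<open>At the threshold \<open>a = 2 c\<close> the distance of \<open>a\<close> from
  \<open>c\<close> reaches \<open>c\<close>. Below it the numerator is at most \<open>c^2\<close>,
  and the singular denominator is left to the average over \<open>r\<close>; above it the
  denominator is at least \<open>2 c + (k - 1) y\<close>, free of the singularity. Hence the
  \<open>2 c\<close> in \<open>V\<close>.\<close>

lemma defect_split:
  assumes a: "a \<ge> 0" and y: "y > 0"
  shows "(a - c)\<^sup>2 / (a + (real k - 1) * y) \<le> c\<^sup>2 / (a + (real k - 1) * y) + (a - c)\<^sup>2 / (2 * c + (real k - 1) * y)"
proof -
  have p: "(real k - 1) * y > 0" using k1 y by (intro mult_pos_pos) auto
  show ?thesis
  proof (cases "a \<le> 2 * c")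
    case True
    have "(a - c)\<^sup>2 \<le> c\<^sup>2" using True a by (intro abs_le_square_iff[THEN iffD1]) (use c in auto)
    then have "(a - c)\<^sup>2 / (a + (real k - 1) * y) \<le> c\<^sup>2 / (a + (real k - 1) * y)"
      using p a by (intro divide_right_mono) auto
    moreover have "0 \<le> (a - c)\<^sup>2 / (2 * c + (real k - 1) * y)" using p c by auto
    ultimately show ?thesis by simp
  next
    case False
    then have "(a - c)\<^sup>2 / (a + (real k - 1) * y) \<le> (a - c)\<^sup>2 / (2 * c + (real k - 1) * y)"
      using p c by (intro divide_left_mono mult_pos_pos) auto
    moreover have "0 \<le> c\<^sup>2 / (a + (real k - 1) * y)" using p a by auto
    ultimately show ?thesis by simp
  qed
qed

definition z :: "real \<Rightarrow> real" where
  "z r = r * (ln ((r - real k * \<mu>) / T)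
                + real k * \<sigma>sq / (4 * (r - real k * \<mu>)\<^sup>2 * ln ((r - real k * \<mu>) / T)))
           + r\<^sup>2 / (4 * real k * T)"

text \<open>The factor \<open>c\<close> of \<open>V\<close> is left out; it cancels against the
  \<open>1 / c\<close> in \<open>U\<close>.\<close>

definition v :: real where "v = (\<integral>t. 1 / (2 * c + (real k - 1) * t) \<partial>\<nu>)"

definition z3 :: real where "z3 = (\<integral>t. real k * t * ln (1 + t / T) \<partial>\<nu>)"

text \<open>All \<open>k\<close> indicators agree, each being the event \<open>S \<le> r\<close>. It
  is kept only on the singular term with \<open>c^2\<close>; the other terms are non-negative and
  are extended beyond the event, so that their expectations become exact moments.\<close>

lemma pointwise_bound:
  fixes t :: "nat \<Rightarrow> real"
  assumes t: "\<And>i. i < k \<Longrightarrow> 0 < t i" and A: "r - real k * \<mu> > T" and r: "r > 0"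
  defines "a \<equiv> \<lambda>i. r - rest i t" and "A \<equiv> r - real k * \<mu>"
  defines "w \<equiv> \<lambda>i. a i + (real k - 1) * t i" and "l \<equiv> ln (A / T)"
  shows "(\<Sum>i<k. indicator {..a i} (t i) * (w i * excess (a i) + ln (real k) * ((a i - c)\<^sup>2 / w i)))
    \<le> real k * r / (4 * A\<^sup>2 * l) * (2 * l * A + real k * \<mu> - (\<Sum>i<k. t i))\<^sup>2 + r\<^sup>2 / (4 * T)
      + (\<Sum>i<k. real k * t i * ln (1 + t i / T))
      + (\<Sum>i<k. ln (real k) * c\<^sup>2 * (if (\<Sum>i<k. t i) \<le> r then 1 / (r - (\<Sum>i<k. t i) + real k * t i) else 0))
      + (\<Sum>i<k. ln (real k) * ((a i - c)\<^sup>2 / (2 * c + (real k - 1) * t i)))"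
proof -
  have lnk: "ln (real k) \<ge> 0" using k by simp
  have A0: "A > T" "A > 0" using A T by (auto simp: A_def)
  have l: "l > 0" unfolding l_def using A0 T by (intro ln_gt_zero) simp
  have ind: "indicator {..a i} (t i) = (if (\<Sum>i<k. t i) \<le> r then 1 else 0 :: real)" if "i < k" for i
    using that by (simp add: a_def rest_eq indicator_def)
  have n1: "real k * r / (4 * A\<^sup>2 * l) * (2 * l * A + real k * \<mu> - (\<Sum>i<k. t i))\<^sup>2 + r\<^sup>2 / (4 * T) \<ge> 0"
    using r l T by (intro add_nonneg_nonneg mult_nonneg_nonneg divide_nonneg_nonneg) auto
  have n2: "(\<Sum>i<k. real k * t i * ln (1 + t i / T)) \<ge> 0"
    using t T by (intro sum_nonneg mult_nonneg_nonneg ln_ge_zero) (auto intro: less_imp_le)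
  have n4: "(a i - c)\<^sup>2 / (2 * c + (real k - 1) * t i) \<ge> 0" if "i < k" for i
    using t[OF that] k1 c by (intro divide_nonneg_nonneg add_nonneg_nonneg mult_nonneg_nonneg) auto
  show ?thesis
  proof (cases "(\<Sum>i<k. t i) \<le> r")
    case False
    have "(\<Sum>i<k. indicator {..a i} (t i) * (w i * excess (a i) + ln (real k) * ((a i - c)\<^sup>2 / w i))) = 0"
      using False ind by (intro sum.neutral) auto
    moreover have "(\<Sum>i<k. ln (real k) * ((a i - c)\<^sup>2 / (2 * c + (real k - 1) * t i))) \<ge> 0"
      using n4 lnk by (intro sum_nonneg mult_nonneg_nonneg) auto
    ultimately show ?thesis using n1 n2 False by simp
  next
    case True
    have "(\<Sum>i<k. indicator {..a i} (t i) * (w i * excess (a i) + ln (real k) * ((a i - c)\<^sup>2 / w i)))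
       = (\<Sum>i<k. w i * excess (a i)) + (\<Sum>i<k. ln (real k) * ((a i - c)\<^sup>2 / w i))"
      using True ind by (simp add: sum.distrib)
    also have "(\<Sum>i<k. w i * excess (a i)) \<le> real k * r * excess (r - (\<Sum>i<k. t i)) + r\<^sup>2 / (4 * T) + (\<Sum>i<k. real k * t i * ln (1 + t i / T))"
      using sum_excess_le[OF t True] by (simp add: w_def a_def)
    \<comment> \<open>\<open>A\<close> is the mean of the gap \<open>r - S\<close>, so the quadratic
      bound is centred there.\<close>
    also have "real k * r * excess (r - (\<Sum>i<k. t i)) \<le> real k * r * ((2 * l * A + (r - (\<Sum>i<k. t i)) - A)\<^sup>2 / (4 * A\<^sup>2 * l))"
      unfolding l_def using r A0 by (intro mult_left_mono excess_le_quadratic) auto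
    also have "\<dots> = real k * r / (4 * A\<^sup>2 * l) * (2 * l * A + real k * \<mu> - (\<Sum>i<k. t i))\<^sup>2"
    proof -
      have "2 * l * A + (r - (\<Sum>i<k. t i)) - A = 2 * l * A + real k * \<mu> - (\<Sum>i<k. t i)" by (simp add: A_def)
      then show ?thesis by (simp only: times_divide_eq_left times_divide_eq_right)
    qed
    also have "(\<Sum>i<k. ln (real k) * ((a i - c)\<^sup>2 / w i))
       \<le> (\<Sum>i<k. ln (real k) * c\<^sup>2 * (1 / (r - (\<Sum>i<k. t i) + real k * t i)) + ln (real k) * ((a i - c)\<^sup>2 / (2 * c + (real k - 1) * t i)))"
    proof (intro sum_mono)
      fix i assume "i \<in> {..<k}"
      then have i: "i < k" by simp
      have ai: "a i \<ge> 0" using True t[OF i] i by (simp add: a_def rest_eq)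
      have wi: "r - (\<Sum>i<k. t i) + real k * t i = w i" using i by (simp add: w_def a_def rest_eq algebra_simps)
      have "ln (real k) * ((a i - c)\<^sup>2 / w i) \<le> ln (real k) * (c\<^sup>2 / w i + (a i - c)\<^sup>2 / (2 * c + (real k - 1) * t i))"
        unfolding w_def using lnk ai t[OF i] by (intro mult_left_mono defect_split) auto
      then show "ln (real k) * ((a i - c)\<^sup>2 / w i) \<le> ln (real k) * c\<^sup>2 * (1 / (r - (\<Sum>i<k. t i) + real k * t i)) + ln (real k) * ((a i - c)\<^sup>2 / (2 * c + (real k - 1) * t i))"
        unfolding wi by (simp add: distrib_left)
    qed
    finally show ?thesis using True by (simp add: sum.distrib)
  qed
qed

text \<open>The square is centred at distance \<open>2 l A\<close> from the mean
  \<open>k \<mu>\<close> of \<open>S\<close>. After division by \<open>4 A^2 l\<close> the squared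
  bias becomes \<open>l\<close> and the variance becomes \<open>k \<sigma>sq / (4 A^2 l)\<close>,
  the two terms in the bracket of \<open>z\<close>.\<close>

lemma quadratic_expectation:
  assumes A: "r - real k * \<mu> > T" and r: "r > 0"
  defines "A \<equiv> r - real k * \<mu>" and "l \<equiv> ln ((r - real k * \<mu>) / T)"
  shows "(\<integral>\<^sup>+t. ennreal (real k * r / (4 * A\<^sup>2 * l) * (2 * l * A + real k * \<mu> - (\<Sum>i<k. t i))\<^sup>2 + r\<^sup>2 / (4 * T)) \<partial>P {..<k})
    = ennreal (real k * z r)" and "z r \<ge> 0"
proof -
  have A0: "A > T" "A > 0" using A T by (auto simp: A_def)
  have l: "l > 0" unfolding l_def A_def[symmetric] using A0 T by (intro ln_gt_zero) simp
  have K: "real k * r / (4 * A\<^sup>2 * l) \<ge> 0" "r\<^sup>2 / (4 * T) \<ge> 0" using r l T by auto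
  have eq': "x * r / (4 * A\<^sup>2 * l) * ((2 * l * A)\<^sup>2 + x * \<sigma>sq) + r\<^sup>2 / (4 * T)
     = x * (r * (l + x * \<sigma>sq / (4 * A\<^sup>2 * l)) + r\<^sup>2 / (4 * x * T))" if "x > 0" for x
    using A0 l T that by (simp add: field_simps power2_eq_square)
  have eq: "real k * r / (4 * A\<^sup>2 * l) * ((2 * l * A)\<^sup>2 + real k * \<sigma>sq) + r\<^sup>2 / (4 * T) = real k * z r"
  proof -
    have "ln (A / T) = l" by (simp add: l_def A_def)
    then show ?thesis unfolding z_def A_def[symmetric] using k by (simp only: , intro eq') simp
  qed
  have "real k * z r \<ge> 0"
    unfolding eq[symmetric] using K \<sigma>sq_nonneg by (intro add_nonneg_nonneg mult_nonneg_nonneg) auto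
  then show "z r \<ge> 0" using k by (simp add: zero_le_mult_iff)
  have "(\<integral>\<^sup>+t. ennreal (real k * r / (4 * A\<^sup>2 * l) * (2 * l * A + real k * \<mu> - (\<Sum>i<k. t i))\<^sup>2 + r\<^sup>2 / (4 * T)) \<partial>P {..<k})
    = (\<integral>\<^sup>+t. ennreal (real k * r / (4 * A\<^sup>2 * l)) * ennreal ((2 * l * A + real k * \<mu> - (\<Sum>i<k. t i))\<^sup>2) + ennreal (r\<^sup>2 / (4 * T)) \<partial>P {..<k})"
    using K by (intro nn_integral_cong) (subst ennreal_mult[symmetric], simp, simp, subst ennreal_plus[symmetric], simp_all only: mult_nonneg_nonneg zero_le_power2)
  also have "\<dots> = ennreal (real k * r / (4 * A\<^sup>2 * l)) * ennreal ((2 * l * A)\<^sup>2 + real k * \<sigma>sq) + ennreal (r\<^sup>2 / (4 * T))"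
    by (subst nn_integral_add, measurable, subst nn_integral_cmult, measurable, subst nn_integral_sum_squares)
       (simp_all add: prob_space.emeasure_space_1[OF prob_space_P])
  also have "\<dots> = ennreal (real k * r / (4 * A\<^sup>2 * l) * ((2 * l * A)\<^sup>2 + real k * \<sigma>sq) + r\<^sup>2 / (4 * T))"
    using K \<sigma>sq_nonneg
    by (subst ennreal_mult[symmetric], simp, simp, subst ennreal_plus[symmetric])
      (simp_all only: mult_nonneg_nonneg add_nonneg_nonneg zero_le_power2 of_nat_0_le_iff)
  finally show "(\<integral>\<^sup>+t. ennreal (real k * r / (4 * A\<^sup>2 * l) * (2 * l * A + real k * \<mu> - (\<Sum>i<k. t i))\<^sup>2 + r\<^sup>2 / (4 * T)) \<partial>P {..<k})
    = ennreal (real k * z r)" unfolding eq .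
qed

lemma z3_nonneg: "z3 \<ge> 0"
  unfolding z3_def using AE_nu T by (intro integral_nonneg_AE) (auto elim!: eventually_mono)

lemma nn_integral_z3: "(\<integral>\<^sup>+t. ennreal (real k * t * ln (1 + t / T)) \<partial>\<nu>) = ennreal z3"
  unfolding z3_def
proof (intro nn_integral_eq_integral integrable_nu_bounded[where B="real k * T * ln (1 + T / T)"])
  show "AE t in \<nu>. 0 \<le> real k * t * ln (1 + t / T)"
    using AE_nu T by (auto elim!: eventually_mono)
  fix t assume t: "0 < t" "t \<le> T"
  have "ln (1 + t / T) \<le> ln (1 + T / T)" using t T by (subst ln_le_cancel_iff) (auto simp: add_pos_pos)
  then show "\<bar>real k * t * ln (1 + t / T)\<bar> \<le> real k * T * ln (1 + T / T)"
    using t T by (subst abs_of_nonneg) (auto intro!: mult_mono)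
qed measurable

lemma v_nonneg: "v \<ge> 0"
  unfolding v_def using AE_nu c k1 by (intro integral_nonneg_AE) (auto elim!: eventually_mono)

lemma nn_integral_v: "(\<integral>\<^sup>+t. ennreal (1 / (2 * c + (real k - 1) * t)) \<partial>\<nu>) = ennreal v"
  unfolding v_def
proof (intro nn_integral_eq_integral integrable_nu_bounded[where B="1 / (2 * c)"])
  show "AE t in \<nu>. 0 \<le> 1 / (2 * c + (real k - 1) * t)"
    using AE_nu c k1 by (auto elim!: eventually_mono)
  fix t assume t: "0 < t" "t \<le> T"
  then have "(real k - 1) * t \<ge> 0" using k1 by auto
  then show "\<bar>1 / (2 * c + (real k - 1) * t)\<bar> \<le> 1 / (2 * c)"
    using c by (subst abs_of_nonneg) (auto intro!: divide_left_mono)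
qed measurable

text \<open>The numerator involves only the other \<open>k - 1\<close> coordinates and the
  denominator only \<open>t i\<close>, so independence splits the expectation into a second moment
  and \<open>v\<close>.\<close>

lemma nn_integral_defect_V:
  assumes i: "i < k"
  shows "(\<integral>\<^sup>+t. ennreal ((r - rest i t - c)\<^sup>2 / (2 * c + (real k - 1) * t i)) \<partial>P {..<k})
    = ennreal (v * ((r - c - (real k - 1) * \<mu>)\<^sup>2 + (real k - 1) * \<sigma>sq))"
proof -
  let ?A = "{..<k} - {i}"
  \<comment> \<open>Valid for every sign of \<open>d\<close>, both sides being 0 for
    \<open>d \<le> 0\<close>. This matters because \<open>y\<close> ranges over the whole line, not
    only over the support of \<open>\<nu>\<close>.\<close>
  have quot: "ennreal (x\<^sup>2 / d) = ennreal (x\<^sup>2) * ennreal (1 / d)" for x d :: real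
    by (subst ennreal_mult'[symmetric]) auto
  have card: "real (card ?A) = real k - 1" using i by (simp add: of_nat_diff)
  have "(\<integral>\<^sup>+t. ennreal ((r - rest i t - c)\<^sup>2 / (2 * c + (real k - 1) * t i)) \<partial>P {..<k})
    = (\<integral>\<^sup>+t. \<integral>\<^sup>+y. ennreal ((r - (\<Sum>j\<in>?A. t j) - c)\<^sup>2 / (2 * c + (real k - 1) * y)) \<partial>\<nu> \<partial>P ?A)"
    by (rule nn_integral_P_split[OF i]) measurable
  also have "(\<integral>\<^sup>+t. \<integral>\<^sup>+y. ennreal ((r - (\<Sum>j\<in>?A. t j) - c)\<^sup>2 / (2 * c + (real k - 1) * y)) \<partial>\<nu> \<partial>P ?A)
    = (\<integral>\<^sup>+t. ennreal ((r - c - (\<Sum>j\<in>?A. t j))\<^sup>2) * ennreal v \<partial>P ?A)"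
  proof (intro nn_integral_cong)
    fix t :: "nat \<Rightarrow> real"
    have "(\<integral>\<^sup>+y. ennreal ((r - (\<Sum>j\<in>?A. t j) - c)\<^sup>2 / (2 * c + (real k - 1) * y)) \<partial>\<nu>)
      = (\<integral>\<^sup>+y. ennreal ((r - c - (\<Sum>j\<in>?A. t j))\<^sup>2) * ennreal (1 / (2 * c + (real k - 1) * y)) \<partial>\<nu>)"
      unfolding quot by (simp only: diff_diff_eq add.commute)
    then show "(\<integral>\<^sup>+y. ennreal ((r - (\<Sum>j\<in>?A. t j) - c)\<^sup>2 / (2 * c + (real k - 1) * y)) \<partial>\<nu>)
       = ennreal ((r - c - (\<Sum>j\<in>?A. t j))\<^sup>2) * ennreal v"
      by (simp add: nn_integral_cmult nn_integral_v)
  qed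
  also have "\<dots> = ennreal ((r - c - (real k - 1) * \<mu>)\<^sup>2 + (real k - 1) * \<sigma>sq) * ennreal v"
    by (subst nn_integral_multc) (auto simp: nn_integral_sum_squares card simp del: card_Diff_insert)
  finally show ?thesis
    using v_nonneg \<sigma>sq_nonneg k1
    by (simp add: ennreal_mult[symmetric] mult.commute del: ennreal_plus)
qed

end

section \<open>One-variable inequalities for the average over the scale\<close>

lemma set_integrable_ln_one_plus_inverse:
  fixes p b :: real
  assumes p: "p > 0" and b: "b > 0"
  shows "set_integrable lborel {0<..<b} (\<lambda>t. ln (1 + p / t))"
proof -
  \<comment> \<open>The integrand is unbounded at 0, so the fundamental theorem is applied on the
    open interval with one-sided limits of this antiderivative.\<close>
  define F where "F t = t * ln (1 + p / t) + p * ln (t + p)" for t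
  have "set_integrable lborel (einterval (ereal 0) (ereal b)) (\<lambda>t. ln (1 + p / t))"
  proof (rule interval_integral_FTC_nonneg(1)[where F=F])
    show "ereal 0 < ereal b" using b by simp
    fix t assume "ereal 0 < ereal t" "ereal t < ereal b"
    then have t: "t > 0" by simp
    then have q: "1 + p / t > 0" using p by (intro add_pos_pos) auto
    have e: "t * (- (p / (t * t)) / (1 + p / t)) = - p / (t + p)"
      using t p by (simp add: divide_simps)
    have "(F has_real_derivative (ln (1 + p / t) + t * (- (p / (t * t)) / (1 + p / t)) + p * (1 / (t + p)))) (at t)"
      unfolding F_def using t p q by (auto intro!: derivative_eq_intros)
    then show "(F has_real_derivative ln (1 + p / t)) (at t)" unfolding e by simp
    show "isCont (\<lambda>t. ln (1 + p / t)) t" using t q by (intro continuous_intros) auto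
  next
    show "AE x in lborel. ereal 0 < ereal x \<longrightarrow> ereal x < ereal b \<longrightarrow> 0 \<le> ln (1 + p / x)"
      using p by auto
    show "((F \<circ> real_of_ereal) \<longlongrightarrow> p * ln p) (at_right (ereal 0))"
      unfolding ereal_tendsto_simps F_def using p by real_asymp
    have "isCont F b"
      unfolding F_def using p b by (intro continuous_intros) (auto simp: add_pos_pos less_imp_neq[symmetric])
    then show "((F \<circ> real_of_ereal) \<longlongrightarrow> F b) (at_left (ereal b))"
      unfolding ereal_tendsto_simps by (simp add: isCont_def filterlim_at_split)
  qed
  moreover have "einterval (ereal 0) (ereal b) = {0<..<b}" by (auto simp: einterval_def)
  ultimately show ?thesis by simp
qed

text \<open>The left-hand side and the first term on the right are \<open>\<integral> r dr\<close> over \<open>[1, 1 + \<tau>]\<close> and \<open>[x, 1 + \<tau>]\<close>.\<close>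
lemma chebyshev_weight:
  fixes x m \<tau> :: real
  assumes \<tau>: "\<tau> > 0" and m: "m \<le> 1 - \<tau>" and x: "1 \<le> x" "x \<le> 1 + \<tau>"
  shows "\<tau> * (1 + \<tau> / 2) \<le> ((1 + \<tau>)\<^sup>2 - x\<^sup>2) / 2 + \<tau> * (1 + \<tau> / 2) * (x - m)\<^sup>2 / (1 + \<tau> - m)\<^sup>2"
proof -
  define A where "A = 1 + \<tau> - m"
  define y where "y = 1 + \<tau> - x"
  have A: "A \<ge> 2 * \<tau>" "A > 0" using m \<tau> by (auto simp: A_def)
  have y: "0 \<le> y" "y \<le> \<tau>" using x by (auto simp: y_def)
  have main: "\<tau> * (2 + \<tau>) * (2 * A - y) \<le> (2 * (1 + \<tau>) - y) * A\<^sup>2"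
  proof -
    \<comment> \<open>Both sides are affine in \<open>y\<close>: interpolate between \<open>y = 0\<close> and \<open>y = \<tau>\<close>.\<close>
    have "0 \<le> (\<tau> - y) * (2 * (1 + \<tau>) * A\<^sup>2 - 2 * \<tau> * (2 + \<tau>) * A) + y * ((2 + \<tau>) * (A - \<tau>)\<^sup>2)"
    proof (intro add_nonneg_nonneg mult_nonneg_nonneg)
      \<comment> \<open>The endpoint \<open>y = 0\<close>, where \<open>A \<ge> 2 * \<tau>\<close>
        is used, a restatement of \<open>m \<le> 1 - \<tau>\<close>. At \<open>y = \<tau>\<close>
        the difference is the square \<open>(A - \<tau>)^2\<close> times
        \<open>2 + \<tau>\<close>.\<close>
      have "2 * \<tau> * (2 + \<tau>) * A \<le> A * (2 + \<tau>) * A" using A \<tau> by (intro mult_right_mono) auto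
      also have "\<dots> \<le> A * (2 + 2 * \<tau>) * A" using A \<tau> by (intro mult_right_mono mult_left_mono) auto
      finally show "0 \<le> 2 * (1 + \<tau>) * A\<^sup>2 - 2 * \<tau> * (2 + \<tau>) * A" by (simp add: power2_eq_square algebra_simps)
    qed (use y \<tau> in auto)
    also have "\<dots> = \<tau> * ((2 * (1 + \<tau>) - y) * A\<^sup>2 - \<tau> * (2 + \<tau>) * (2 * A - y))"
      by (simp add: power2_eq_square algebra_simps)
    finally show ?thesis using \<tau> by (simp add: zero_le_mult_iff)
  qed
  have half: "\<tau> * (1 + \<tau> / 2) * B \<le> D / 2 * B + \<tau> * (1 + \<tau> / 2) * C"
    if "\<tau> * (2 + \<tau>) * (B - C) \<le> D * B" for B C D :: real
  proof -
    have "\<tau> * (1 + \<tau> / 2) = \<tau> * (2 + \<tau>) / 2" by simp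
    moreover have "K / 2 * B \<le> D / 2 * B + K / 2 * C" if "K * (B - C) \<le> D * B" for K
      using that by (simp add: right_diff_distrib)
    ultimately show ?thesis using that by (simp only:)
  qed
  \<comment> \<open>Both differences of squares contain the factor \<open>y\<close>;
    \<open>main\<close> compares the cofactors.\<close>
  have "\<tau> * (2 + \<tau>) * (A\<^sup>2 - (A - y)\<^sup>2) = y * (\<tau> * (2 + \<tau>) * (2 * A - y))"
    by (simp add: power2_eq_square algebra_simps)
  also have "\<dots> \<le> y * ((2 * (1 + \<tau>) - y) * A\<^sup>2)" using main y by (intro mult_left_mono) auto
  also have "y * (2 * (1 + \<tau>) - y) = (1 + \<tau>)\<^sup>2 - x\<^sup>2" by (simp add: y_def power2_eq_square algebra_simps)
  then have "y * ((2 * (1 + \<tau>) - y) * A\<^sup>2) = ((1 + \<tau>)\<^sup>2 - x\<^sup>2) * A\<^sup>2" by (simp only: mult.assoc[symmetric])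
  finally have "\<tau> * (1 + \<tau> / 2) * A\<^sup>2 \<le> ((1 + \<tau>)\<^sup>2 - x\<^sup>2) / 2 * A\<^sup>2 + \<tau> * (1 + \<tau> / 2) * (A - y)\<^sup>2"
    by (rule half)
  then have "\<tau> * (1 + \<tau> / 2) \<le> (((1 + \<tau>)\<^sup>2 - x\<^sup>2) / 2 * A\<^sup>2 + \<tau> * (1 + \<tau> / 2) * (A - y)\<^sup>2) / A\<^sup>2"
    using A by (subst pos_le_divide_eq) auto
  also have "\<dots> = ((1 + \<tau>)\<^sup>2 - x\<^sup>2) / 2 + \<tau> * (1 + \<tau> / 2) * (A - y)\<^sup>2 / A\<^sup>2"
    using A by (simp add: add_divide_distrib)
  also have "A - y = x - m" by (simp add: A_def y_def)
  finally show ?thesis unfolding A_def .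
qed

text \<open>Meant for \<open>x = S\<close> and \<open>m = k \<mu>\<close>. Chebyshev applied at each
  scale would cost \<open>k \<sigma>sq / (r - k \<mu>)^2\<close>; the averaged inequality has the
  largest of these divisors, the one at \<open>r = 1 + \<tau>\<close>. For \<open>x \<le> 1\<close>
  the integral alone suffices, for \<open>x > 1 + \<tau>\<close> the quadratic term alone.\<close>

lemma chebyshev_weight_nn:
  fixes x m \<tau> :: real
  assumes \<tau>: "\<tau> > 0" and m: "m \<le> 1 - \<tau>"
  shows "ennreal (\<tau> * (1 + \<tau> / 2))
    \<le> (\<integral>\<^sup>+r. ennreal (if x \<le> r then r else 0) * indicator {1..1 + \<tau>} r \<partial>lborel)
      + ennreal (\<tau> * (1 + \<tau> / 2) / (1 + \<tau> - m)\<^sup>2 * (m - x)\<^sup>2)"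
proof (cases "x \<le> 1 + \<tau>")
  case True
  define q where "q = max 1 x"
  have q: "1 \<le> q" "q \<le> 1 + \<tau>" using True \<tau> by (auto simp: q_def)
  have "(\<integral>\<^sup>+r. ennreal (if x \<le> r then r else 0) * indicator {1..1 + \<tau>} r \<partial>lborel)
    = (\<integral>\<^sup>+r. ennreal r * indicator {q..1 + \<tau>} r \<partial>lborel)"
    by (intro nn_integral_cong) (auto simp: q_def split: split_indicator)
  also have "\<dots> = ennreal ((1 + \<tau>)\<^sup>2 / 2 - q\<^sup>2 / 2)"
    using q by (intro nn_integral_FTC_Icc[where F="\<lambda>r. r\<^sup>2 / 2"]) (auto intro!: derivative_eq_intros)
  finally have I: "(\<integral>\<^sup>+r. ennreal (if x \<le> r then r else 0) * indicator {1..1 + \<tau>} r \<partial>lborel) = ennreal ((1 + \<tau>)\<^sup>2 / 2 - q\<^sup>2 / 2)" .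
  have q2: "q\<^sup>2 \<le> (1 + \<tau>)\<^sup>2" using q by (intro power_mono) auto
  have "\<tau> * (1 + \<tau> / 2) \<le> (1 + \<tau>)\<^sup>2 / 2 - q\<^sup>2 / 2 + \<tau> * (1 + \<tau> / 2) / (1 + \<tau> - m)\<^sup>2 * (m - x)\<^sup>2"
  proof (cases "x \<le> 1")
    case True
    then have "(1 + \<tau>)\<^sup>2 / 2 - q\<^sup>2 / 2 = \<tau> * (1 + \<tau> / 2)" by (simp add: q_def power2_eq_square field_simps)
    then show ?thesis using \<tau> by simp
  next
    case False
    then show ?thesis
      using chebyshev_weight[OF \<tau> m, of x] \<open>x \<le> 1 + \<tau>\<close>
      by (simp add: q_def power2_commute[of x m] diff_divide_distrib)
  qed
  then have "ennreal (\<tau> * (1 + \<tau> / 2)) \<le> ennreal ((1 + \<tau>)\<^sup>2 / 2 - q\<^sup>2 / 2 + \<tau> * (1 + \<tau> / 2) / (1 + \<tau> - m)\<^sup>2 * (m - x)\<^sup>2)"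
    by (rule ennreal_leI)
  also have "\<dots> = ennreal ((1 + \<tau>)\<^sup>2 / 2 - q\<^sup>2 / 2) + ennreal (\<tau> * (1 + \<tau> / 2) / (1 + \<tau> - m)\<^sup>2 * (m - x)\<^sup>2)"
    using q2 \<tau> by (intro ennreal_plus mult_nonneg_nonneg divide_nonneg_nonneg) auto
  finally show ?thesis unfolding I .
next
  case False
  have A: "1 + \<tau> - m > 0" using m \<tau> by simp
  have "(1 + \<tau> - m)\<^sup>2 \<le> (x - m)\<^sup>2" using False A by (intro power_mono) auto
  then have "\<tau> * (1 + \<tau> / 2) * 1 \<le> \<tau> * (1 + \<tau> / 2) * ((m - x)\<^sup>2 / (1 + \<tau> - m)\<^sup>2)"
    using A \<tau> by (intro mult_left_mono) (auto simp: power2_commute[of x m])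
  then have "ennreal (\<tau> * (1 + \<tau> / 2)) \<le> ennreal (\<tau> * (1 + \<tau> / 2) / (1 + \<tau> - m)\<^sup>2 * (m - x)\<^sup>2)"
    by (intro ennreal_leI) simp
  then show ?thesis by (rule order_trans) simp
qed

text \<open>The gain from averaging, with \<open>x = S\<close> and \<open>y = k t i\<close>: the
  bound does not depend on \<open>x\<close>, and \<open>1 / y\<close> is improved to a logarithm
  that is integrable at 0. The worst position is \<open>x = 1\<close>, where equality holds.\<close>

lemma nn_integral_reciprocal_le_ln:
  fixes x y \<tau> :: real
  assumes \<tau>: "\<tau> > 0" and y: "y > 0"
  shows "(\<integral>\<^sup>+r. ennreal (if x \<le> r then 1 / (r - x + y) else 0) * indicator {1..1 + \<tau>} r \<partial>lborel) \<le> ennreal (ln (1 + \<tau> / y))"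
proof (cases "x \<le> 1 + \<tau>")
  case True
  define q where "q = max 1 x"
  have q: "1 \<le> q" "q \<le> 1 + \<tau>" "x \<le> q" using True \<tau> by (auto simp: q_def)
  have "(\<integral>\<^sup>+r. ennreal (if x \<le> r then 1 / (r - x + y) else 0) * indicator {1..1 + \<tau>} r \<partial>lborel)
    = (\<integral>\<^sup>+r. ennreal (1 / (r - x + y)) * indicator {q..1 + \<tau>} r \<partial>lborel)"
    by (intro nn_integral_cong) (auto simp: q_def split: split_indicator)
  also have "\<dots> = ennreal (ln (1 + \<tau> - x + y) - ln (q - x + y))"
    using q y by (intro nn_integral_FTC_Icc[where F="\<lambda>r. ln (r - x + y)"]) (auto intro!: derivative_eq_intros)
  also have "\<dots> \<le> ennreal (ln (1 + \<tau> / y))"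
  proof (rule ennreal_leI)
    have "(1 + \<tau> - x + y) / (q - x + y) \<le> 1 + \<tau> / (q - x + y)"
    proof -
      have "1 + \<tau> / (q - x + y) = (q - x + y + \<tau>) / (q - x + y)" using q y by (simp add: add_divide_distrib)
      then show ?thesis using q y by (simp add: divide_right_mono)
    qed
    also have "\<dots> \<le> 1 + \<tau> / y" using q y \<tau> by (intro add_left_mono divide_left_mono) auto
    finally have "ln ((1 + \<tau> - x + y) / (q - x + y)) \<le> ln (1 + \<tau> / y)"
      using q y \<tau> by (subst ln_le_cancel_iff) (auto intro!: divide_pos_pos add_pos_pos)
    then show "ln (1 + \<tau> - x + y) - ln (q - x + y) \<le> ln (1 + \<tau> / y)"
      using q y by (simp add: ln_div)
  qed
  finally show ?thesis .
next
  case False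
  then have "(\<integral>\<^sup>+r. ennreal (if x \<le> r then 1 / (r - x + y) else 0) * indicator {1..1 + \<tau>} r \<partial>lborel) = (\<integral>\<^sup>+r. 0 \<partial>(lborel :: real measure))"
    by (intro nn_integral_cong) (auto split: split_indicator)
  then show ?thesis by simp
qed

lemma ennreal_add_le: "ennreal (a + b) \<le> ennreal a + ennreal b"
proof -
  have "ennreal (a + b) \<le> ennreal (max 0 a + max 0 b)" by (intro ennreal_leI) simp
  also have "\<dots> = ennreal (max 0 a) + ennreal (max 0 b)" by (intro ennreal_plus) auto
  also have "ennreal (max 0 x) = ennreal x" for x by (cases "0 \<le> x") (auto simp: ennreal_neg)
  finally show ?thesis by simp
qed

section \<open>The summed inequality at one scale\<close>

context weight begin

text \<open>The density of \<open>\<nu>\<close> is at most \<open>1 / (c^2 m\<^sub>2)\<close>, which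
  reduces the claim to Lebesgue measure.\<close>

lemma integrable_nu_ln:
  assumes \<tau>: "\<tau> > 0"
  shows "integrable \<nu> (\<lambda>t. ln (1 + \<tau> / (real k * t)))"
proof -
  have p: "\<tau> / real k > 0" using \<tau> k by simp
  have eq: "1 + \<tau> / (real k * t) = 1 + (\<tau> / real k) / t" for t by simp
  have i: "integrable lborel (\<lambda>t. 1 / (c\<^sup>2 * m\<^sub>2) * (indicator {0<..<T} t * ln (1 + (\<tau> / real k) / t)))"
    using set_integrable_ln_one_plus_inverse[OF p T] by (simp add: set_integrable_def)
  have ae: "AE t in lborel. t \<noteq> 0 \<and> t \<noteq> T"
    using AE_lborel_singleton[of 0] AE_lborel_singleton[of T] by eventually_elim auto
  have "integrable lborel (\<lambda>t. dens t / m\<^sub>2 * ln (1 + (\<tau> / real k) / t))"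
  proof (rule Bochner_Integration.integrable_bound[OF i])
    show "AE t in lborel. norm (dens t / m\<^sub>2 * ln (1 + (\<tau> / real k) / t))
      \<le> norm (1 / (c\<^sup>2 * m\<^sub>2) * (indicator {0<..<T} t * ln (1 + (\<tau> / real k) / t)))"
      using ae
    proof eventually_elim
      case (elim t)
      show ?case
      proof (cases "t \<in> {0<..<T}")
        case False
        then show ?thesis using elim by (auto simp: dens_def split: split_indicator)
      next
        case True
        have "c \<le> c + (real k - 1) * t" using True k1 by simp
        then have "g t \<le> 1 / c" unfolding g_def using c by (intro divide_left_mono) auto
        then have "(g t)\<^sup>2 \<le> (1 / c)\<^sup>2" using g_pos[of t] True by (intro power_mono) auto
        then have "dens t \<le> 1 / c\<^sup>2" using True by (simp add: dens_def power_divide)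
        then have "dens t / m\<^sub>2 \<le> 1 / (c\<^sup>2 * m\<^sub>2)" using m2_pos by (simp add: divide_right_mono flip: divide_divide_eq_left)
        then have "\<bar>dens t / m\<^sub>2\<bar> * \<bar>ln (1 + (\<tau> / real k) / t)\<bar> \<le> \<bar>1 / (c\<^sup>2 * m\<^sub>2)\<bar> * \<bar>ln (1 + (\<tau> / real k) / t)\<bar>"
          using dens_nonneg[of t] m2_pos by (intro mult_right_mono) auto
        then show ?thesis using True by (simp add: abs_mult)
      qed
    qed
  qed measurable
  then show ?thesis
    unfolding \<nu>_def eq using m2_pos dens_nonneg by (subst integrable_density) auto
qed

lemma cdf_sum_mono: "r \<le> s \<Longrightarrow> cdf_sum r \<le> cdf_sum s"
  unfolding cdf_sum_def by (intro prod.finite_measure_mono) auto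

text \<open>If the event were null, \<open>S \<ge> 1\<close> would hold almost surely and the mean
  \<open>k \<mu>\<close> would be at least 1. By monotonicity every test function with
  \<open>r \<ge> 1\<close> is then nonzero.\<close>

lemma cdf_sum_pos:
  assumes "real k * \<mu> < 1"
  shows "cdf_sum 1 > 0"
proof (rule ccontr)
  let ?E = "{t \<in> space (P {..<k}). (\<Sum>i<k. t i) \<le> 1}"
  assume "\<not> cdf_sum 1 > 0"
  then have "measure (P {..<k}) ?E = 0" unfolding cdf_sum_def using measure_nonneg[of "P {..<k}" ?E] by linarith
  then have "AE t in P {..<k}. t \<notin> ?E"
    by (intro AE_not_in) (auto simp: null_sets_def prod.emeasure_eq_measure)
  moreover have "AE t in P {..<k}. t \<in> space (P {..<k})" by (rule AE_space)
  ultimately have ae: "AE t in P {..<k}. 1 \<le> (\<Sum>i<k. t i)" by eventually_elim auto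
  have i: "integrable (P {..<k}) (\<lambda>t. t i)" "(\<integral>t. t i \<partial>P {..<k}) = \<mu>" if "i < k" for i
    using integrable_P_component[of i "{..<k}", OF _ integrable_nu_id] that by (auto simp: \<mu>_def)
  have "(\<integral>t. 1 \<partial>P {..<k}) \<le> (\<integral>t. (\<Sum>i<k. t i) \<partial>P {..<k})"
    using ae i by (intro integral_mono_AE) auto
  also have "\<dots> = real k * \<mu>" using i by (subst Bochner_Integration.integral_sum) auto
  finally show False using assms by (simp add: prob_space.prob_space[OF prob_space_P])
qed

text \<open>The singular part \<open>1 / w\<close>, with \<open>w\<close> rewritten as
  \<open>r - S + k t i\<close>. It takes values in \<open>ennreal\<close> because no bound on its
  expectation at a fixed \<open>r\<close> is available, only on the integral over
  \<open>r\<close>.\<close>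

definition reciprocal_term :: "nat \<Rightarrow> real \<Rightarrow> (nat \<Rightarrow> real) \<Rightarrow> ennreal" where
  "reciprocal_term i r t = ennreal (if (\<Sum>i<k. t i) \<le> r then 1 / (r - (\<Sum>i<k. t i) + real k * t i) else 0)"

text \<open>\<open>\<delta>\<close> is \<open>(k - 1) / k\<close> times the gap to be estimated, and
  the factor \<open>k\<close> throughout comes from summing over the coordinates. The test function
  bounds the squares of \<open>G\<close> by means of \<open>m\<close>; the right side, possibly
  infinite, collects the losses.\<close>

lemma fixed_r_bound:
  assumes M: "M_trunc k T = ereal m" and r: "r \<ge> 1" and A: "r - real k * \<mu> > T" and mu: "real k * \<mu> < 1"
  defines "\<delta> \<equiv> ln (real k) - (real k - 1) / real k * m"
  shows "ennreal (real k * \<delta> * (r * cdf_sum r))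
    \<le> ennreal (real k * z r) + ennreal (real k * z3)
      + (\<Sum>i<k. ennreal (ln (real k) * c\<^sup>2) * (\<integral>\<^sup>+t. reciprocal_term i r t \<partial>P {..<k}))
      + ennreal (real k * ln (real k) * v * ((r - c - (real k - 1) * \<mu>)\<^sup>2 + (real k - 1) * \<sigma>sq))"
    (is "_ \<le> ?R")
proof -
  have r0: "r > 0" using r by simp
  have lnk: "ln (real k) \<ge> 0" using k by simp
  have k0: "real k > 0" using k by simp
  have pos: "cdf_sum r > 0" using cdf_sum_pos[OF mu] cdf_sum_mono[OF r] by simp
  define E where "E i = (\<integral>t. (G (r - (\<Sum>j\<in>{..<k} - {i}. t j)))\<^sup>2 \<partial>P ({..<k} - {i}))" for i
  have E0: "E i \<ge> 0" for i unfolding E_def by (intro integral_nonneg_AE) auto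
  have "ereal ((\<Sum>i<k. E i) / (r * m\<^sub>2 * cdf_sum r)) \<le> ereal m"
    using M_trunc_lower_bound[OF r pos] M by (simp add: E_def)
  then have sumE: "(\<Sum>i<k. E i) \<le> m * (r * m\<^sub>2 * cdf_sum r)"
    using pos r0 m2_pos by (simp add: pos_divide_le_eq)
  define a where "a i t = r - rest i t" for i t
  define w where "w i t = a i t + (real k - 1) * t i" for i t
  define u where "u i t = indicator {..a i t} (t i) * (w i t * excess (a i t) + ln (real k) * ((a i t - c)\<^sup>2 / w i t))" for i t
  have am [measurable]: "a i \<in> borel_measurable (P {..<k})" for i unfolding a_def[abs_def] by measurable
  have wm [measurable]: "w i \<in> borel_measurable (P {..<k})" if "i < k" for i
  proof -
    have "i \<in> {..<k}" using that by simp
    then show ?thesis unfolding w_def[abs_def] by measurable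
  qed
  have um: "(\<lambda>t. ennreal (u i t)) \<in> borel_measurable (P {..<k})" if "i < k" for i
  proof -
    have "i \<in> {..<k}" using that by simp
    then show ?thesis unfolding u_def[abs_def] using that by measurable
  qed
  have aeP: "AE t in P {..<k}. \<forall>i<k. 0 < t i"
    using AE_P[of "{..<k}"] by (auto elim!: eventually_mono)
  have wpos: "w i t \<ge> 0" if "i < k" "t i \<le> a i t" "0 < t i" for i t
    unfolding w_def using that k1 by (intro add_nonneg_nonneg mult_nonneg_nonneg) auto
  have ind: "indicator {..a i t} (t i) = (if (\<Sum>i<k. t i) \<le> r then 1 else 0 :: real)" if "i < k" for i t
    using that by (simp add: a_def rest_eq indicator_def)
  let ?E = "{t \<in> space (P {..<k}). (\<Sum>i<k. t i) \<le> r}"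
  have "ennreal (ln (real k) * (real k * (r * cdf_sum r))) = ennreal (ln (real k) * (real k * r)) * emeasure (P {..<k}) ?E"
    using lnk r0 by (simp add: cdf_sum_def prod.emeasure_eq_measure ennreal_mult[symmetric] mult.assoc)
  also have "\<dots> = (\<integral>\<^sup>+t. ennreal (ln (real k) * (real k * r)) * indicator ?E t \<partial>P {..<k})"
    by (subst nn_integral_cmult_indicator) measurable
  also have "\<dots> = (\<integral>\<^sup>+t. (\<Sum>i<k. ennreal (indicator {..a i t} (t i) * (ln (real k) * w i t))) \<partial>P {..<k})"
  proof (rule nn_integral_cong_AE)
    show "AE t in P {..<k}. ennreal (ln (real k) * (real k * r)) * indicator ?E t = (\<Sum>i<k. ennreal (indicator {..a i t} (t i) * (ln (real k) * w i t)))"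
      using aeP AE_space
    proof eventually_elim
      case (elim t)
      have "(\<Sum>i<k. ennreal (indicator {..a i t} (t i) * (ln (real k) * w i t))) = ennreal (\<Sum>i<k. indicator {..a i t} (t i) * (ln (real k) * w i t))"
        using elim lnk wpos by (intro sum_ennreal) (auto split: split_indicator)
      also have "(\<Sum>i<k. indicator {..a i t} (t i) * (ln (real k) * w i t)) = (if (\<Sum>i<k. t i) \<le> r then ln (real k) * (\<Sum>i<k. w i t) else 0)"
        using ind by (simp add: sum_distrib_left)
      also have "(\<Sum>i<k. w i t) = (\<Sum>i<k. r - (\<Sum>i<k. t i) + real k * t i)"
        by (intro sum.cong) (auto simp: w_def a_def rest_eq algebra_simps)
      also have "\<dots> = real k * r" by (simp add: sum.distrib sum_subtractf sum_distrib_left[symmetric] algebra_simps)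
      finally show ?case using elim(2) by (simp split: split_indicator)
    qed
  qed
  also have "\<dots> = (\<Sum>i<k. \<integral>\<^sup>+t. ennreal (indicator {..a i t} (t i) * (ln (real k) * w i t)) \<partial>P {..<k})"
  proof (rule nn_integral_sum)
    fix i assume "i \<in> {..<k}"
    then show "(\<lambda>t. ennreal (indicator {..a i t} (t i) * (ln (real k) * w i t))) \<in> borel_measurable (P {..<k})"
      by (auto intro!: measurable_indicator_atMost)
  qed
  also have "\<dots> \<le> (\<Sum>i<k. ennreal ((real k - 1) / m\<^sub>2 * E i) + (\<integral>\<^sup>+t. ennreal (u i t) \<partial>P {..<k}))"
    unfolding u_def w_def a_def E_def by (intro sum_mono nn_integral_cauchy_schwarz_defect) auto
  also have "\<dots> = ennreal (\<Sum>i<k. (real k - 1) / m\<^sub>2 * E i) + (\<Sum>i<k. \<integral>\<^sup>+t. ennreal (u i t) \<partial>P {..<k})"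
    unfolding sum.distrib using E0 k1 m2_pos by (subst sum_ennreal) auto
  also have "(\<Sum>i<k. \<integral>\<^sup>+t. ennreal (u i t) \<partial>P {..<k}) = (\<integral>\<^sup>+t. (\<Sum>i<k. ennreal (u i t)) \<partial>P {..<k})"
    using um by (intro nn_integral_sum[symmetric]) auto
  also have "(\<Sum>i<k. (real k - 1) / m\<^sub>2 * E i) = (real k - 1) / m\<^sub>2 * (\<Sum>i<k. E i)" by (simp only: sum_distrib_left)
  also have "ennreal ((real k - 1) / m\<^sub>2 * (\<Sum>i<k. E i)) \<le> ennreal ((real k - 1) * m * (r * cdf_sum r))"
  proof (rule ennreal_leI)
    have "(real k - 1) / m\<^sub>2 * (\<Sum>i<k. E i) \<le> (real k - 1) / m\<^sub>2 * (m * (r * m\<^sub>2 * cdf_sum r))"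
      using sumE k1 m2_pos by (intro mult_left_mono) auto
    then show "(real k - 1) / m\<^sub>2 * (\<Sum>i<k. E i) \<le> (real k - 1) * m * (r * cdf_sum r)"
      using m2_pos by (simp add: mult_ac)
  qed
  also have "(\<integral>\<^sup>+t. (\<Sum>i<k. ennreal (u i t)) \<partial>P {..<k}) \<le> ?R"
  proof -
    define l B where "l = ln ((r - real k * \<mu>) / T)" and "B = r - real k * \<mu>"
    define q where "q t = real k * r / (4 * B\<^sup>2 * l) * (2 * l * B + real k * \<mu> - (\<Sum>i<k. t i))\<^sup>2 + r\<^sup>2 / (4 * T)" for t :: "nat \<Rightarrow> real"
    have [measurable]: "q \<in> borel_measurable (P {..<k})" unfolding q_def[abs_def] by measurable
    have l: "l > 0" unfolding l_def using A T by (intro ln_gt_zero) simp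
    have q0: "q t \<ge> 0" for t unfolding q_def using r0 T l by (intro add_nonneg_nonneg mult_nonneg_nonneg) auto
    have pm: "(\<lambda>t. reciprocal_term i r t) \<in> borel_measurable (P {..<k})"
      "(\<lambda>t. ennreal (ln (real k)) * ennreal ((a i t - c)\<^sup>2 / (2 * c + (real k - 1) * t i))) \<in> borel_measurable (P {..<k})"
      "(\<lambda>t. ennreal (real k * t i * ln (1 + t i / T))) \<in> borel_measurable (P {..<k})" if "i \<in> {..<k}" for i
      using that unfolding reciprocal_term_def[abs_def] by measurable
    have "(\<integral>\<^sup>+t. (\<Sum>i<k. ennreal (u i t)) \<partial>P {..<k})
       \<le> (\<integral>\<^sup>+t. ennreal (q t) + (\<Sum>i<k. ennreal (real k * t i * ln (1 + t i / T)))
            + (\<Sum>i<k. ennreal (ln (real k) * c\<^sup>2) * reciprocal_term i r t)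
            + (\<Sum>i<k. ennreal (ln (real k)) * ennreal ((a i t - c)\<^sup>2 / (2 * c + (real k - 1) * t i))) \<partial>P {..<k})"
    proof (rule nn_integral_mono_AE)
      show "AE t in P {..<k}. (\<Sum>i<k. ennreal (u i t))
        \<le> ennreal (q t) + (\<Sum>i<k. ennreal (real k * t i * ln (1 + t i / T)))
            + (\<Sum>i<k. ennreal (ln (real k) * c\<^sup>2) * reciprocal_term i r t)
            + (\<Sum>i<k. ennreal (ln (real k)) * ennreal ((a i t - c)\<^sup>2 / (2 * c + (real k - 1) * t i)))"
        using aeP
      proof eventually_elim
        case (elim t)
        have u0: "u i t \<ge> 0" if "i < k" for i
          unfolding u_def using wpos[OF that] elim that lnk excess_nonneg
          by (auto split: split_indicator)
        have n2: "real k * t i * ln (1 + t i / T) \<ge> 0" if "i < k" for i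
          using elim that T by (intro mult_nonneg_nonneg ln_ge_zero) (auto intro: less_imp_le)
        have n3: "ln (real k) * c\<^sup>2 * (if (\<Sum>i<k. t i) \<le> r then 1 / (r - (\<Sum>i<k. t i) + real k * t i) else 0) \<ge> 0" if "i < k" for i
        proof -
          have "real k * t i \<ge> 0" using elim that by (intro mult_nonneg_nonneg) (auto intro: less_imp_le)
          then show ?thesis using lnk by (intro mult_nonneg_nonneg) auto
        qed
        have n4: "(a i t - c)\<^sup>2 / (2 * c + (real k - 1) * t i) \<ge> 0" if "i < k" for i
          using elim that k1 c by (intro divide_nonneg_nonneg add_nonneg_nonneg mult_nonneg_nonneg) (auto intro: less_imp_le)
        have s2: "(\<Sum>i<k. ennreal (real k * t i * ln (1 + t i / T))) = ennreal (\<Sum>i<k. real k * t i * ln (1 + t i / T))"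
          using n2 by (intro sum_ennreal) auto
        have s3: "(\<Sum>i<k. ennreal (ln (real k) * c\<^sup>2) * reciprocal_term i r t)
          = ennreal (\<Sum>i<k. ln (real k) * c\<^sup>2 * (if (\<Sum>i<k. t i) \<le> r then 1 / (r - (\<Sum>i<k. t i) + real k * t i) else 0))"
          unfolding reciprocal_term_def using n3 lnk by (subst sum_ennreal[symmetric]) (auto simp only: ennreal_mult' mult_nonneg_nonneg zero_le_power2 lessThan_iff)
        have s4: "(\<Sum>i<k. ennreal (ln (real k)) * ennreal ((a i t - c)\<^sup>2 / (2 * c + (real k - 1) * t i)))
          = ennreal (\<Sum>i<k. ln (real k) * ((a i t - c)\<^sup>2 / (2 * c + (real k - 1) * t i)))"
          using n4 lnk by (subst sum_ennreal[symmetric]) (auto simp only: ennreal_mult' mult_nonneg_nonneg lessThan_iff)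
        have "(\<Sum>i<k. ennreal (u i t)) = ennreal (\<Sum>i<k. u i t)" using u0 by (intro sum_ennreal) auto
        also have "\<dots> \<le> ennreal (q t + (\<Sum>i<k. real k * t i * ln (1 + t i / T))
            + (\<Sum>i<k. ln (real k) * c\<^sup>2 * (if (\<Sum>i<k. t i) \<le> r then 1 / (r - (\<Sum>i<k. t i) + real k * t i) else 0))
            + (\<Sum>i<k. ln (real k) * ((a i t - c)\<^sup>2 / (2 * c + (real k - 1) * t i))))"
          using pointwise_bound[of t r] elim A r0
          by (intro ennreal_leI) (auto simp: u_def w_def a_def q_def l_def B_def)
        also have "\<dots> \<le> ennreal (q t) + ennreal (\<Sum>i<k. real k * t i * ln (1 + t i / T))
            + ennreal (\<Sum>i<k. ln (real k) * c\<^sup>2 * (if (\<Sum>i<k. t i) \<le> r then 1 / (r - (\<Sum>i<k. t i) + real k * t i) else 0))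
            + ennreal (\<Sum>i<k. ln (real k) * ((a i t - c)\<^sup>2 / (2 * c + (real k - 1) * t i)))"
          by (intro order_trans[OF ennreal_add_le] add_mono order_refl)
        finally show ?case unfolding s2 s3 s4 .
      qed
    qed
    also have "\<dots> = (\<integral>\<^sup>+t. ennreal (q t) \<partial>P {..<k}) + (\<Sum>i<k. \<integral>\<^sup>+t. ennreal (real k * t i * ln (1 + t i / T)) \<partial>P {..<k})
            + (\<Sum>i<k. ennreal (ln (real k) * c\<^sup>2) * (\<integral>\<^sup>+t. reciprocal_term i r t \<partial>P {..<k}))
            + (\<Sum>i<k. ennreal (ln (real k)) * (\<integral>\<^sup>+t. ennreal ((a i t - c)\<^sup>2 / (2 * c + (real k - 1) * t i)) \<partial>P {..<k}))"
    proof -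
      define f2 where "f2 t = (\<Sum>i<k. ennreal (real k * t i * ln (1 + t i / T)))" for t :: "nat \<Rightarrow> real"
      define f3 where "f3 t = (\<Sum>i<k. ennreal (ln (real k) * c\<^sup>2) * reciprocal_term i r t)" for t
      define f4 where "f4 t = (\<Sum>i<k. ennreal (ln (real k)) * ennreal ((a i t - c)\<^sup>2 / (2 * c + (real k - 1) * t i)))" for t
      have [measurable]: "f2 \<in> borel_measurable (P {..<k})" "f3 \<in> borel_measurable (P {..<k})" "f4 \<in> borel_measurable (P {..<k})"
        unfolding f2_def[abs_def] f3_def[abs_def] f4_def[abs_def] using pm
        by (auto intro!: borel_measurable_sum borel_measurable_times)
      have "(\<integral>\<^sup>+t. ennreal (q t) + f2 t + f3 t + f4 t \<partial>P {..<k})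
        = (\<integral>\<^sup>+t. ennreal (q t) \<partial>P {..<k}) + (\<integral>\<^sup>+t. f2 t \<partial>P {..<k}) + (\<integral>\<^sup>+t. f3 t \<partial>P {..<k}) + (\<integral>\<^sup>+t. f4 t \<partial>P {..<k})"
        by (simp add: nn_integral_add)
      moreover have "(\<integral>\<^sup>+t. f2 t \<partial>P {..<k}) = (\<Sum>i<k. \<integral>\<^sup>+t. ennreal (real k * t i * ln (1 + t i / T)) \<partial>P {..<k})"
        unfolding f2_def using pm by (intro nn_integral_sum) auto
      moreover have "(\<integral>\<^sup>+t. f3 t \<partial>P {..<k}) = (\<Sum>i<k. ennreal (ln (real k) * c\<^sup>2) * (\<integral>\<^sup>+t. reciprocal_term i r t \<partial>P {..<k}))"
        unfolding f3_def using pm by (subst nn_integral_sum) (auto intro!: sum.cong nn_integral_cmult)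
      moreover have "(\<integral>\<^sup>+t. f4 t \<partial>P {..<k})
        = (\<Sum>i<k. \<integral>\<^sup>+t. ennreal (ln (real k)) * ennreal ((a i t - c)\<^sup>2 / (2 * c + (real k - 1) * t i)) \<partial>P {..<k})"
        unfolding f4_def using pm by (intro nn_integral_sum) auto
      moreover have "\<dots> = (\<Sum>i<k. ennreal (ln (real k)) * (\<integral>\<^sup>+t. ennreal ((a i t - c)\<^sup>2 / (2 * c + (real k - 1) * t i)) \<partial>P {..<k}))"
      proof (intro sum.cong refl nn_integral_cmult)
        fix i assume i: "i \<in> {..<k}"
        then show "(\<lambda>t. ennreal ((a i t - c)\<^sup>2 / (2 * c + (real k - 1) * t i))) \<in> borel_measurable (P {..<k})"
          by measurable
      qed
      ultimately show ?thesis by (simp only: f2_def f3_def f4_def)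
    qed
    also have "(\<integral>\<^sup>+t. ennreal (q t) \<partial>P {..<k}) = ennreal (real k * z r)"
      using quadratic_expectation(1)[OF A r0] by (simp only: q_def l_def B_def)
    also have "(\<Sum>i<k. \<integral>\<^sup>+t. ennreal (real k * t i * ln (1 + t i / T)) \<partial>P {..<k}) = ennreal (real k * z3)"
    proof -
      have "(\<Sum>i<k. \<integral>\<^sup>+t. ennreal (real k * t i * ln (1 + t i / T)) \<partial>P {..<k}) = (\<Sum>i<k. ennreal z3)"
      proof (intro sum.cong refl)
        fix i assume "i \<in> {..<k}"
        then show "(\<integral>\<^sup>+t. ennreal (real k * t i * ln (1 + t i / T)) \<partial>P {..<k}) = ennreal z3"
          using nn_integral_P_component[of i "{..<k}" "\<lambda>s. ennreal (real k * s * ln (1 + s / T))"] nn_integral_z3 by simp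
      qed
      then show ?thesis using z3_nonneg by (simp add: ennreal_mult ennreal_of_nat_eq_real_of_nat)
    qed
    also have "(\<Sum>i<k. ennreal (ln (real k)) * (\<integral>\<^sup>+t. ennreal ((a i t - c)\<^sup>2 / (2 * c + (real k - 1) * t i)) \<partial>P {..<k}))
      = ennreal (real k * ln (real k) * v * ((r - c - (real k - 1) * \<mu>)\<^sup>2 + (real k - 1) * \<sigma>sq))"
    proof -
      define y where "y = (r - c - (real k - 1) * \<mu>)\<^sup>2 + (real k - 1) * \<sigma>sq"
      have y: "y \<ge> 0" unfolding y_def using k1 \<sigma>sq_nonneg by (intro add_nonneg_nonneg mult_nonneg_nonneg) auto
      have "(\<Sum>i<k. ennreal (ln (real k)) * (\<integral>\<^sup>+t. ennreal ((a i t - c)\<^sup>2 / (2 * c + (real k - 1) * t i)) \<partial>P {..<k}))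
        = (\<Sum>i<k. ennreal (ln (real k)) * ennreal (v * y))"
        unfolding a_def y_def by (intro sum.cong refl arg_cong2[where f="(*)"] nn_integral_defect_V) auto
      also have "\<dots> = ennreal (real k * ln (real k) * v * y)"
        using lnk v_nonneg y by (simp add: ennreal_mult ennreal_of_nat_eq_real_of_nat mult.assoc)
      finally show ?thesis by (simp only: y_def)
    qed
    finally show ?thesis .
  qed
  finally have "ennreal (ln (real k) * (real k * (r * cdf_sum r))) \<le> ennreal ((real k - 1) * m * (r * cdf_sum r)) + ?R"
    by (simp add: add_mono)
  then have "ennreal (ln (real k) * (real k * (r * cdf_sum r)) - (real k - 1) * m * (r * cdf_sum r)) \<le> ?R"
  proof (rule ennreal_diff_le)
    \<comment> \<open>Moving the term with \<open>m\<close> across requires its sign, and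
      \<open>m \<ge> 0\<close> because it bounds a quotient of non-negative integrals.\<close>
    have "0 \<le> (\<Sum>i<k. E i)" using E0 by (intro sum_nonneg) auto
    then have "0 \<le> m * (r * m\<^sub>2 * cdf_sum r)" using sumE by linarith
    moreover have "r * m\<^sub>2 * cdf_sum r > 0" using pos r0 m2_pos by (intro mult_pos_pos)
    ultimately have "0 \<le> m" by (simp add: zero_le_mult_iff)
    then show "0 \<le> (real k - 1) * m * (r * cdf_sum r)" using k1 pos r0 by auto
  qed
  also have "ln (real k) * (real k * (r * cdf_sum r)) - (real k - 1) * m * (r * cdf_sum r) = real k * \<delta> * (r * cdf_sum r)"
  proof -
    have "real k * ((real k - 1) / real k * m) = (real k - 1) * m" using k0 by simp
    then show ?thesis unfolding \<delta>_def by (simp only: right_diff_distrib left_diff_distrib mult_ac)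
  qed
  finally show ?thesis .
qed

end

section \<open>Averaging over the scale\<close>

lemma nn_integral_Icc_continuous:
  fixes f :: "real \<Rightarrow> real"
  assumes f: "continuous_on {a..b} f" "\<And>r. r \<in> {a..b} \<Longrightarrow> f r \<ge> 0"
  shows "(\<integral>\<^sup>+r. ennreal (f r) * indicator {a..b} r \<partial>lborel) = ennreal (LBINT r:{a..b}. f r)"
    "(LBINT r:{a..b}. f r) \<ge> 0"
proof -
  have "set_integrable lborel {a..b} f" using f(1) by (rule borel_integrable_atLeastAtMost')
  then have i: "integrable lborel (\<lambda>r. indicator {a..b} r *\<^sub>R f r)" by (simp add: set_integrable_def)
  have "(\<integral>\<^sup>+r. ennreal (f r) * indicator {a..b} r \<partial>lborel) = (\<integral>\<^sup>+r. ennreal (indicator {a..b} r *\<^sub>R f r) \<partial>lborel)"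
    by (intro nn_integral_cong) (auto split: split_indicator)
  also have "\<dots> = ennreal (LBINT r:{a..b}. f r)"
    unfolding set_lebesgue_integral_def using f(2)
    by (intro nn_integral_eq_integral i) (auto split: split_indicator)
  finally show "(\<integral>\<^sup>+r. ennreal (f r) * indicator {a..b} r \<partial>lborel) = ennreal (LBINT r:{a..b}. f r)" .
  show "(LBINT r:{a..b}. f r) \<ge> 0"
    unfolding set_lebesgue_integral_def using f(2) by (intro integral_nonneg_AE) (auto split: split_indicator)
qed

context weight begin

definition W :: "real \<Rightarrow> real" where
  "W \<tau> = (\<integral>t. ln (1 + \<tau> / (real k * t)) \<partial>\<nu>)"

lemma nn_integral_W:
  assumes "\<tau> > 0"
  shows "(\<integral>\<^sup>+t. ennreal (ln (1 + \<tau> / (real k * t))) \<partial>\<nu>) = ennreal (W \<tau>)" "W \<tau> \<ge> 0"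
proof -
  have ae: "AE t in \<nu>. 0 \<le> ln (1 + \<tau> / (real k * t))"
    using AE_nu by (rule eventually_mono) (use assms in \<open>auto intro!: ln_ge_zero\<close>)
  show "(\<integral>\<^sup>+t. ennreal (ln (1 + \<tau> / (real k * t))) \<partial>\<nu>) = ennreal (W \<tau>)"
    unfolding W_def using integrable_nu_ln[OF assms] ae by (rule nn_integral_eq_integral)
  show "W \<tau> \<ge> 0"
    unfolding W_def using ae by (rule integral_nonneg_AE)
qed

lemma Fubini_P_lborel:
  assumes "case_prod f \<in> borel_measurable (P {..<k} \<Otimes>\<^sub>M lborel)"
  shows "(\<integral>\<^sup>+r. \<integral>\<^sup>+t. f t r \<partial>P {..<k} \<partial>(lborel :: real measure)) = (\<integral>\<^sup>+t. \<integral>\<^sup>+r. f t r \<partial>lborel \<partial>P {..<k})"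
proof -
  interpret pair_sigma_finite "P {..<k}" "lborel :: real measure"
    by (intro pair_sigma_finite.intro prob_space_imp_sigma_finite prob_space_P sigma_finite_lborel)
  show ?thesis using assms by (rule Fubini')
qed

lemma reciprocal_term_measurable:
  assumes "i < k"
  shows "(\<lambda>(t, r). reciprocal_term i r t) \<in> borel_measurable (P {..<k} \<Otimes>\<^sub>M lborel)"
proof -
  have "i \<in> {..<k}" using assms by simp
  then show ?thesis unfolding reciprocal_term_def[abs_def] by measurable
qed

lemma nn_integral_reciprocal_term:
  assumes \<tau>: "\<tau> > 0" and i: "i < k"
  shows "(\<integral>\<^sup>+r. (\<integral>\<^sup>+t. reciprocal_term i r t \<partial>P {..<k}) * indicator {1..1 + \<tau>} r \<partial>lborel) \<le> ennreal (W \<tau>)"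
proof -
  note [measurable] = reciprocal_term_measurable[OF i]
  have m1: "(\<lambda>t. reciprocal_term i r t) \<in> borel_measurable (P {..<k})" for r
  proof -
    have "i \<in> {..<k}" using i by simp
    then show ?thesis unfolding reciprocal_term_def by measurable
  qed
  have "(\<integral>\<^sup>+r. (\<integral>\<^sup>+t. reciprocal_term i r t \<partial>P {..<k}) * indicator {1..1 + \<tau>} r \<partial>lborel)
     = (\<integral>\<^sup>+r. \<integral>\<^sup>+t. reciprocal_term i r t * indicator {1..1 + \<tau>} r \<partial>P {..<k} \<partial>lborel)"
    by (intro nn_integral_cong nn_integral_multc[symmetric] m1)
  also have "\<dots> = (\<integral>\<^sup>+t. \<integral>\<^sup>+r. reciprocal_term i r t * indicator {1..1 + \<tau>} r \<partial>lborel \<partial>P {..<k})"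
    by (rule Fubini_P_lborel) measurable
  also have "\<dots> \<le> (\<integral>\<^sup>+t. ennreal (ln (1 + \<tau> / (real k * t i))) \<partial>P {..<k})"
  proof (rule nn_integral_mono_AE)
    show "AE t in P {..<k}. (\<integral>\<^sup>+r. reciprocal_term i r t * indicator {1..1 + \<tau>} r \<partial>lborel) \<le> ennreal (ln (1 + \<tau> / (real k * t i)))"
      using AE_P[OF finite_lessThan]
    proof eventually_elim
      case (elim t)
      then show ?case
        unfolding reciprocal_term_def using \<tau> i k by (intro nn_integral_reciprocal_le_ln) auto
    qed
  qed
  also have "\<dots> = ennreal (W \<tau>)"
    using nn_integral_P_component[of i "{..<k}" "\<lambda>s. ennreal (ln (1 + \<tau> / (real k * s)))"] i nn_integral_W(1)[OF \<tau>]
    by simp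
  finally show ?thesis .
qed

text \<open>The expectation of \<open>chebyshev_weight_nn\<close> at \<open>x = S\<close>, with the
  order of integration exchanged; the second moment of \<open>S\<close> about its mean supplies
  \<open>k \<sigma>sq\<close>.\<close>

lemma cdf_sum_average:
  assumes \<tau>: "\<tau> > 0" and mu: "real k * \<mu> \<le> 1 - \<tau>"
  shows "ennreal (\<tau> * (1 + \<tau> / 2) * (1 - real k * \<sigma>sq / (1 + \<tau> - real k * \<mu>)\<^sup>2))
    \<le> (\<integral>\<^sup>+r. ennreal (r * cdf_sum r) * indicator {1..1 + \<tau>} r \<partial>lborel)"
proof -
  define \<kappa> where "\<kappa> = \<tau> * (1 + \<tau> / 2)"
  have \<kappa>: "\<kappa> > 0" using \<tau> by (simp add: \<kappa>_def)
  define K where "K = \<kappa> / (1 + \<tau> - real k * \<mu>)\<^sup>2"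
  have K: "K \<ge> 0" using \<kappa> by (simp add: K_def)
  let ?s = "\<lambda>t::nat \<Rightarrow> real. \<Sum>i<k. t i"
  let ?f = "\<lambda>t r. ennreal (if ?s t \<le> r then r else 0) * indicator {1..1 + \<tau>} r"
  have fm: "(\<lambda>(t, r). ?f t r) \<in> borel_measurable (P {..<k} \<Otimes>\<^sub>M lborel)" by measurable
  have "(\<integral>\<^sup>+r. ennreal (r * cdf_sum r) * indicator {1..1 + \<tau>} r \<partial>lborel) = (\<integral>\<^sup>+r. \<integral>\<^sup>+t. ?f t r \<partial>P {..<k} \<partial>lborel)"
  proof (intro nn_integral_cong)
    fix r :: real
    let ?E = "{t \<in> space (P {..<k}). ?s t \<le> r}"
    show "ennreal (r * cdf_sum r) * indicator {1..1 + \<tau>} r = (\<integral>\<^sup>+t. ?f t r \<partial>P {..<k})"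
    proof (cases "r \<in> {1..1 + \<tau>}")
      case True
      have "(\<integral>\<^sup>+t. ?f t r \<partial>P {..<k}) = (\<integral>\<^sup>+t. ennreal r * indicator ?E t \<partial>P {..<k})"
        using True by (intro nn_integral_cong) (auto split: split_indicator)
      also have "\<dots> = ennreal r * emeasure (P {..<k}) ?E" by (intro nn_integral_cmult_indicator) measurable
      also have "\<dots> = ennreal (r * cdf_sum r)"
        using True by (simp add: cdf_sum_def prod.emeasure_eq_measure ennreal_mult)
      finally show ?thesis using True by simp
    qed simp
  qed
  also have "\<dots> = (\<integral>\<^sup>+t. \<integral>\<^sup>+r. ?f t r \<partial>lborel \<partial>P {..<k})"
    by (rule Fubini_P_lborel[OF fm])
  finally have swap: "(\<integral>\<^sup>+r. ennreal (r * cdf_sum r) * indicator {1..1 + \<tau>} r \<partial>lborel) = (\<integral>\<^sup>+t. \<integral>\<^sup>+r. ?f t r \<partial>lborel \<partial>P {..<k})" .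
  have im: "(\<lambda>t. \<integral>\<^sup>+r. ?f t r \<partial>lborel) \<in> borel_measurable (P {..<k})"
    using fm by (rule sigma_finite_measure.borel_measurable_nn_integral[OF sigma_finite_lborel])
  have "ennreal \<kappa> = (\<integral>\<^sup>+t. ennreal \<kappa> \<partial>P {..<k})"
    by (simp add: prob_space.emeasure_space_1[OF prob_space_P])
  also have "\<dots> \<le> (\<integral>\<^sup>+t. (\<integral>\<^sup>+r. ?f t r \<partial>lborel) + ennreal (K * (real k * \<mu> - ?s t)\<^sup>2) \<partial>P {..<k})"
    unfolding K_def \<kappa>_def by (intro nn_integral_mono chebyshev_weight_nn \<tau> mu)
  also have "\<dots> = (\<integral>\<^sup>+t. \<integral>\<^sup>+r. ?f t r \<partial>lborel \<partial>P {..<k}) + (\<integral>\<^sup>+t. ennreal (K * (real k * \<mu> - ?s t)\<^sup>2) \<partial>P {..<k})"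
    by (rule nn_integral_add[OF im]) measurable
  also have "(\<integral>\<^sup>+t. ennreal (K * (real k * \<mu> - ?s t)\<^sup>2) \<partial>P {..<k}) = ennreal K * ennreal (real k * \<sigma>sq)"
    using K nn_integral_sum_squares[of "{..<k}" "real k * \<mu>"] by (simp add: ennreal_mult nn_integral_cmult)
  also have "\<dots> = ennreal (K * (real k * \<sigma>sq))" using K \<sigma>sq_nonneg by (simp add: ennreal_mult)
  finally have "ennreal (\<kappa> - K * (real k * \<sigma>sq)) \<le> (\<integral>\<^sup>+t. \<integral>\<^sup>+r. ?f t r \<partial>lborel \<partial>P {..<k})"
    using K \<sigma>sq_nonneg by (intro ennreal_diff_le) (auto simp: add.commute)
  also have "\<kappa> - K * (real k * \<sigma>sq) = \<kappa> * (1 - real k * \<sigma>sq / (1 + \<tau> - real k * \<mu>)\<^sup>2)"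
    by (simp add: K_def right_diff_distrib)
  finally show ?thesis unfolding \<kappa>_def swap .
qed

text \<open>The assumption says that the mean gap \<open>r - k \<mu>\<close> exceeds
  \<open>T\<close> already at \<open>r = 1\<close>. Hence the logarithm, which also stands in a
  denominator, is positive on the whole interval.\<close>

lemma continuous_z:
  assumes "1 - real k * \<mu> > T"
  shows "continuous_on {1..1 + \<tau>} z"
proof -
  have "r - real k * \<mu> > T" if "r \<in> {1..1 + \<tau>}" for r using that assms by auto
  then have *: "(r - real k * \<mu>) / T > 1" "r - real k * \<mu> > 0" if "r \<in> {1..1 + \<tau>}" for r using that T by fastforce+
  then have "ln ((r - real k * \<mu>) / T) > 0" if "r \<in> {1..1 + \<tau>}" for r using that by (intro ln_gt_zero)
  with * show ?thesis
    unfolding z_def using T k by (intro continuous_intros) force+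
qed

lemma integrals_nonneg:
  assumes "\<tau> > 0" "1 - real k * \<mu> > T"
  shows "(LBINT r:{1..1 + \<tau>}. z r) \<ge> 0"
    "(LBINT r:{1..1 + \<tau>}. (r - c - (real k - 1) * \<mu>)\<^sup>2 + (real k - 1) * \<sigma>sq) \<ge> 0"
proof -
  show "(LBINT r:{1..1 + \<tau>}. z r) \<ge> 0"
    using continuous_z[OF assms(2)] quadratic_expectation(2) assms(2)
    by (intro nn_integral_Icc_continuous(2)) auto
  show "(LBINT r:{1..1 + \<tau>}. (r - c - (real k - 1) * \<mu>)\<^sup>2 + (real k - 1) * \<sigma>sq) \<ge> 0"
    using k1 \<sigma>sq_nonneg
    by (intro nn_integral_Icc_continuous(2) continuous_intros add_nonneg_nonneg mult_nonneg_nonneg) auto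
qed

text \<open>\<open>\<delta> \<ge> 0\<close> allows it to be moved in and out of extended
  non-negative integrals. After the integration every term on the right is finite, so the inequality
  returns to the reals and the common factor \<open>k\<close> cancels.\<close>

lemma average_bound:
  assumes M: "M_trunc k T = ereal m" and \<tau>: "\<tau> > 0" and mu: "real k * \<mu> \<le> 1 - \<tau>" "real k * \<mu> < 1 - T"
  defines "\<delta> \<equiv> ln (real k) - (real k - 1) / real k * m"
  assumes \<delta>: "\<delta> \<ge> 0"
  shows "\<delta> * (\<tau> * (1 + \<tau> / 2) * (1 - real k * \<sigma>sq / (1 + \<tau> - real k * \<mu>)\<^sup>2))
    \<le> (LBINT r:{1..1 + \<tau>}. z r) + \<tau> * z3 + ln (real k) * c\<^sup>2 * W \<tau>
      + ln (real k) * v * (LBINT r:{1..1 + \<tau>}. (r - c - (real k - 1) * \<mu>)\<^sup>2 + (real k - 1) * \<sigma>sq)"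
    (is "\<delta> * ?C \<le> ?Z + _ + _ + _ * ?U")
proof -
  have lnk: "ln (real k) \<ge> 0" using k by simp
  have k0: "real k > 0" using k by simp
  let ?I = "indicator {1..1 + \<tau>} :: real \<Rightarrow> ennreal"
  let ?y = "\<lambda>r. (r - c - (real k - 1) * \<mu>)\<^sup>2 + (real k - 1) * \<sigma>sq"
  have y0: "?y r \<ge> 0" for r using k1 \<sigma>sq_nonneg by (intro add_nonneg_nonneg mult_nonneg_nonneg) auto
  have z0: "z r \<ge> 0" if "r \<in> {1..1 + \<tau>}" for r
    using quadratic_expectation(2)[of r] mu T that by auto
  have zm [measurable]: "z \<in> borel_measurable borel" unfolding z_def[abs_def] by measurable
  have nonneg: "?Z \<ge> 0" "?U \<ge> 0" "\<tau> * z3 \<ge> 0" "ln (real k) * c\<^sup>2 * W \<tau> \<ge> 0" "ln (real k) * v * ?U \<ge> 0"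
    using integrals_nonneg[OF \<tau>] mu \<tau> z3_nonneg lnk v_nonneg nn_integral_W(2)[OF \<tau>] by auto
  define Rt where "Rt i r = (\<integral>\<^sup>+t. reciprocal_term i r t \<partial>P {..<k})" for i r
  have Rtm: "Rt i \<in> borel_measurable lborel" if "i < k" for i
  proof -
    have "i \<in> {..<k}" using that by simp
    then have "(\<lambda>(r, t). reciprocal_term i r t) \<in> borel_measurable (lborel \<Otimes>\<^sub>M P {..<k})"
      unfolding reciprocal_term_def[abs_def] by measurable
    then show ?thesis
      unfolding Rt_def[abs_def]
      by (rule sigma_finite_measure.borel_measurable_nn_integral[OF prob_space_imp_sigma_finite[OF prob_space_P]])
  qed
  define R where "R r = (\<Sum>i<k. ennreal (ln (real k) * c\<^sup>2) * Rt i r)" for r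
  have Rm [measurable]: "R \<in> borel_measurable lborel"
    unfolding R_def[abs_def] using Rtm by (auto intro!: borel_measurable_sum borel_measurable_times)
  have "ennreal (real k * \<delta> * ?C) = ennreal (real k * \<delta>) * ennreal ?C"
    using k0 \<delta> by (intro ennreal_mult') auto
  also have "\<dots> \<le> ennreal (real k * \<delta>) * (\<integral>\<^sup>+r. ennreal (r * cdf_sum r) * ?I r \<partial>lborel)"
    by (intro mult_left_mono cdf_sum_average \<tau> mu) auto
  also have "\<dots> = (\<integral>\<^sup>+r. ennreal (real k * \<delta>) * (ennreal (r * cdf_sum r) * ?I r) \<partial>lborel)"
  proof (rule nn_integral_cmult[symmetric])
    have "cdf_sum \<in> borel_measurable borel" by (intro borel_measurable_mono monoI cdf_sum_mono)
    then show "(\<lambda>r. ennreal (r * cdf_sum r) * ?I r) \<in> borel_measurable lborel" by measurable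
  qed
  also have "\<dots> \<le> (\<integral>\<^sup>+r. ennreal (real k * z r) * ?I r + ennreal (real k * z3) * ?I r + R r * ?I r
      + ennreal (real k * ln (real k) * v * ?y r) * ?I r \<partial>lborel)"
  proof (intro nn_integral_mono)
    fix r :: real
    show "ennreal (real k * \<delta>) * (ennreal (r * cdf_sum r) * ?I r) \<le> ennreal (real k * z r) * ?I r + ennreal (real k * z3) * ?I r + R r * ?I r
      + ennreal (real k * ln (real k) * v * ?y r) * ?I r"
    proof (cases "r \<in> {1..1 + \<tau>}")
      case True
      then have r: "r \<ge> 1" "r - real k * \<mu> > T" "real k * \<mu> < 1" using mu T by auto
      have "ennreal (real k * \<delta>) * ennreal (r * cdf_sum r) = ennreal (real k * \<delta> * (r * cdf_sum r))"
        using k0 \<delta> by (intro ennreal_mult'[symmetric]) auto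
      then show ?thesis
        using fixed_r_bound[OF M r] True by (simp add: \<delta>_def R_def Rt_def)
    qed simp
  qed
  also have "\<dots> = (\<integral>\<^sup>+r. ennreal (real k * z r) * ?I r \<partial>lborel) + (\<integral>\<^sup>+r. ennreal (real k * z3) * ?I r \<partial>lborel) + (\<integral>\<^sup>+r. R r * ?I r \<partial>lborel)
      + (\<integral>\<^sup>+r. ennreal (real k * ln (real k) * v * ?y r) * ?I r \<partial>lborel)"
    by (simp add: nn_integral_add)
  also have "(\<integral>\<^sup>+r. ennreal (real k * z r) * ?I r \<partial>lborel) = ennreal (real k * ?Z)"
    using z0 k0 mu continuous_z[of \<tau>] by (subst nn_integral_Icc_continuous) (auto intro!: continuous_intros)
  also have "(\<integral>\<^sup>+r. ennreal (real k * z3) * ?I r \<partial>lborel) = ennreal (real k * (\<tau> * z3))"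
    using \<tau> z3_nonneg k0 by (subst nn_integral_cmult_indicator) (auto simp: ennreal_mult[symmetric] mult_ac)
  also have "(\<integral>\<^sup>+r. R r * ?I r \<partial>lborel) \<le> ennreal (real k * (ln (real k) * c\<^sup>2 * W \<tau>))"
  proof -
    have "(\<integral>\<^sup>+r. R r * ?I r \<partial>lborel) = (\<Sum>i<k. \<integral>\<^sup>+r. ennreal (ln (real k) * c\<^sup>2) * (Rt i r * ?I r) \<partial>lborel)"
      unfolding R_def sum_distrib_right mult.assoc using Rtm by (intro nn_integral_sum) auto
    also have "\<dots> = (\<Sum>i<k. ennreal (ln (real k) * c\<^sup>2) * (\<integral>\<^sup>+r. Rt i r * ?I r \<partial>lborel))"
      using Rtm by (intro sum.cong refl nn_integral_cmult) auto
    also have "\<dots> \<le> (\<Sum>i<k. ennreal (ln (real k) * c\<^sup>2) * ennreal (W \<tau>))"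
      unfolding Rt_def by (intro sum_mono mult_left_mono nn_integral_reciprocal_term \<tau>) auto
    also have "\<dots> = ennreal (real k * (ln (real k) * c\<^sup>2 * W \<tau>))"
      using lnk nn_integral_W(2)[OF \<tau>] by (simp add: ennreal_mult ennreal_of_nat_eq_real_of_nat mult.assoc)
    finally show ?thesis .
  qed
  also have "(\<integral>\<^sup>+r. ennreal (real k * ln (real k) * v * ?y r) * ?I r \<partial>lborel) = ennreal (real k * (ln (real k) * v * ?U))"
    using y0 k0 lnk v_nonneg by (subst nn_integral_Icc_continuous) (auto intro!: continuous_intros mult_nonneg_nonneg simp: mult.assoc simp del: mult_eq_0_iff)
  also have "ennreal (real k * ?Z) + ennreal (real k * (\<tau> * z3)) + ennreal (real k * (ln (real k) * c\<^sup>2 * W \<tau>)) + ennreal (real k * (ln (real k) * v * ?U))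
    = ennreal (real k * (?Z + \<tau> * z3 + ln (real k) * c\<^sup>2 * W \<tau> + ln (real k) * v * ?U))"
    using k0 nonneg by (simp add: distrib_left ennreal_plus[symmetric] del: ennreal_plus)
  finally have "ennreal (real k * \<delta> * ?C) \<le> ennreal (real k * (?Z + \<tau> * z3 + ln (real k) * c\<^sup>2 * W \<tau> + ln (real k) * v * ?U))"
    by (simp add: add_mono)
  then have "real k * \<delta> * ?C \<le> real k * (?Z + \<tau> * z3 + ln (real k) * c\<^sup>2 * W \<tau> + ln (real k) * v * ?U)"
    using k0 nonneg by (subst (asm) ennreal_le_iff) auto
  then show ?thesis using k0 by (simp add: mult.assoc)
qed

section \<open>From the averaged inequality to the theorem\<close>

lemma U_substitution:
  assumes "\<tau> > 0"
  shows "(LBINT r:{1..1 + \<tau>}. (r - c - (real k - 1) * \<mu>)\<^sup>2 + (real k - 1) * \<sigma>sq)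
    = \<tau> * (LBINT u:{0..1}. (1 + u * \<tau> - (real k - 1) * \<mu> - c)\<^sup>2 + (real k - 1) * \<sigma>sq)"
proof -
  have "indicator {1..1 + \<tau>} (1 + \<tau> * u) = (indicator {0..1} u :: real)" for u
  proof -
    have "1 \<le> 1 + \<tau> * u \<longleftrightarrow> 0 \<le> u" using assms by (simp add: zero_le_mult_iff)
    moreover have "1 + \<tau> * u \<le> 1 + \<tau> \<longleftrightarrow> u \<le> 1" using assms by simp
    ultimately show ?thesis by (simp add: indicator_def)
  qed
  then have "(LBINT r:{1..1 + \<tau>}. (r - c - (real k - 1) * \<mu>)\<^sup>2 + (real k - 1) * \<sigma>sq)
    = \<tau> * (LBINT u:{0..1}. (1 + \<tau> * u - c - (real k - 1) * \<mu>)\<^sup>2 + (real k - 1) * \<sigma>sq)"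
    unfolding set_lebesgue_integral_def
    using assms lborel_integral_real_affine[of \<tau> "\<lambda>r. indicator {1..1 + \<tau>} r *\<^sub>R ((r - c - (real k - 1) * \<mu>)\<^sup>2 + (real k - 1) * \<sigma>sq)" 1]
    by simp
  moreover have "1 + \<tau> * u - c - (real k - 1) * \<mu> = 1 + u * \<tau> - (real k - 1) * \<mu> - c" for u
    by (simp add: mult.commute)
  ultimately show ?thesis by simp
qed

text \<open>The family is not empty: the test function at \<open>r = 1\<close> belongs to it. A
  value of minus infinity would make the left side of the final bound infinite.\<close>

lemma M_trunc_not_MInf:
  assumes "real k * \<mu> < 1"
  shows "M_trunc k T \<noteq> - \<infinity>"
  using M_trunc_lower_bound[of 1] cdf_sum_pos[OF assms] by auto

lemma M_trunc_bound:
  assumes \<tau>: "\<tau> > 0" and mu: "real k * \<mu> \<le> 1 - \<tau>" "real k * \<mu> < 1 - T"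
    and var: "real k * \<sigma>sq < (1 + \<tau> - real k * \<mu>)\<^sup>2"
  defines "Z \<equiv> 1 / \<tau> * (LBINT r:{1..1 + \<tau>}. z r)"
    and "X \<equiv> ln (real k) / \<tau> * c\<^sup>2"
    and "U \<equiv> ln (real k) / c * (LBINT u:{0..1}. (1 + u * \<tau> - (real k - 1) * \<mu> - c)\<^sup>2 + (real k - 1) * \<sigma>sq)"
  shows "ereal (real k / (real k - 1) * ln (real k)) - M_trunc k T
    \<le> ereal (real k / (real k - 1) * ((Z + z3 + W \<tau> * X + c * v * U) /
         ((1 + \<tau> / 2) * (1 - real k * \<sigma>sq / (1 + \<tau> - real k * \<mu>)\<^sup>2))))"
proof (cases "M_trunc k T")
  case MInf
  then show ?thesis using M_trunc_not_MInf mu T by simp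
next
  case PInf
  \<comment> \<open>An infinite supremum makes the left side minus infinity.\<close>
  then show ?thesis by simp
next
  case (real m)
  define \<delta> where "\<delta> = ln (real k) - (real k - 1) / real k * m"
  define q where "q = (1 + \<tau> / 2) * (1 - real k * \<sigma>sq / (1 + \<tau> - real k * \<mu>)\<^sup>2)"
  have A: "1 + \<tau> - real k * \<mu> > 0" using mu T \<tau> by simp
  \<comment> \<open>The variance hypothesis is exactly the positivity of the Chebyshev
    factor.\<close>
  have q: "q > 0" unfolding q_def using var A \<tau> by (intro mult_pos_pos) auto
  let ?Z = "LBINT r:{1..1 + \<tau>}. z r"
  let ?U = "LBINT r:{1..1 + \<tau>}. (r - c - (real k - 1) * \<mu>)\<^sup>2 + (real k - 1) * \<sigma>sq"
  define N where "N = Z + z3 + W \<tau> * X + c * v * U"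
  have N: "\<tau> * N = ?Z + \<tau> * z3 + ln (real k) * c\<^sup>2 * W \<tau> + ln (real k) * v * ?U"
    unfolding N_def Z_def X_def U_def U_substitution[OF \<tau>] using \<tau> c by (simp add: distrib_left)
  have "\<tau> * N \<ge> 0"
    unfolding N using integrals_nonneg[OF \<tau>] mu z3_nonneg v_nonneg nn_integral_W(2)[OF \<tau>] k \<tau>
    by (intro add_nonneg_nonneg mult_nonneg_nonneg) auto
  then have N0: "N \<ge> 0" using \<tau> by (simp add: zero_le_mult_iff)
  have "\<delta> \<le> N / q"
  \<comment> \<open>The averaged inequality is available for \<open>\<delta> \<ge> 0\<close>;
    otherwise the claim holds because \<open>N / q\<close> is non-negative.\<close>
  proof (cases "\<delta> \<ge> 0")
    case True
    have "\<tau> * (\<delta> * q) \<le> \<tau> * N"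
      unfolding N q_def using average_bound[OF real \<tau> mu] True by (simp add: \<delta>_def mult_ac)
    then show ?thesis using \<tau> q by (simp add: pos_le_divide_eq)
  next
    case False
    moreover have "0 \<le> N / q" using N0 q by simp
    ultimately show ?thesis by linarith
  qed
  then have "real k / (real k - 1) * \<delta> \<le> real k / (real k - 1) * (N / q)"
    using k1 by (intro mult_left_mono) auto
  moreover have "real k / (real k - 1) * \<delta> = real k / (real k - 1) * ln (real k) - m"
    unfolding \<delta>_def right_diff_distrib using k k1 by simp
  ultimately show ?thesis by (simp add: real N_def q_def)
qed

lemma M_trunc_le_M_sup: "M_trunc k T \<le> M_sup k"
proof -
  have "truncated_simplex_region k T \<subseteq> simplex_region k"
    by (auto simp: truncated_simplex_region_def simplex_region_def PiE_iff)
  then show ?thesis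
    unfolding M_trunc_def M_sup_def by (intro SUP_subset_mono) (auto simp: admissible_def)
qed

end

theorem theorem5p7:
  fixes k :: nat and c T \<tau> :: real and g :: "real \<Rightarrow> real"
    and m\<^sub>2 \<mu> \<sigma>sq Z Z\<^sub>3 W X V U :: real
  assumes "k \<ge> 2" and "c > 0" and "T > 0" and "\<tau> > 0"
    and "\<forall>t\<in>{0..T}. g t = 1 / (c + (real k - 1) * t)"
    and "m\<^sub>2 = (LBINT t:{0..T}. (g t)\<^sup>2)"
    and "\<mu> = 1 / m\<^sub>2 * (LBINT t:{0..T}. t * (g t)\<^sup>2)"
    and "\<sigma>sq = 1 / m\<^sub>2 * (LBINT t:{0..T}. t\<^sup>2 * (g t)\<^sup>2) - \<mu>\<^sup>2"
    and "real k * \<mu> \<le> 1 - \<tau>"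
    and "real k * \<mu> < 1 - T"
    and "real k * \<sigma>sq < (1 + \<tau> - real k * \<mu>)\<^sup>2"
    and "Z = 1 / \<tau> * (LBINT r:{1..1 + \<tau>}.
           r * (ln ((r - real k * \<mu>) / T)
                + real k * \<sigma>sq / (4 * (r - real k * \<mu>)\<^sup>2 * ln ((r - real k * \<mu>) / T)))
           + r\<^sup>2 / (4 * real k * T))"
    and "Z\<^sub>3 = 1 / m\<^sub>2 * (LBINT t:{0..T}. real k * t * ln (1 + t / T) * (g t)\<^sup>2)"
    and "W = 1 / m\<^sub>2 * (LBINT t:{0..T}. ln (1 + \<tau> / (real k * t)) * (g t)\<^sup>2)"
    and "X = ln (real k) / \<tau> * c\<^sup>2"
    and "V = c / m\<^sub>2 * (LBINT t:{0..T}. 1 / (2 * c + (real k - 1) * t) * (g t)\<^sup>2)"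
    and "U = ln (real k) / c * (LBINT u:{0..1}.
           (1 + u * \<tau> - (real k - 1) * \<mu> - c)\<^sup>2 + (real k - 1) * \<sigma>sq)"
  shows "ereal (real k / (real k - 1) * ln (real k)) - M_trunc k T
           \<le> ereal (real k / (real k - 1) *
               ((Z + Z\<^sub>3 + W * X + V * U) /
                ((1 + \<tau> / 2) * (1 - real k * \<sigma>sq / (1 + \<tau> - real k * \<mu>)\<^sup>2))))
       \<and> ereal (real k / (real k - 1) * ln (real k)) - M_sup k
           \<le> ereal (real k / (real k - 1) *
               ((Z + Z\<^sub>3 + W * X + V * U) /
                ((1 + \<tau> / 2) * (1 - real k * \<sigma>sq / (1 + \<tau> - real k * \<mu>)\<^sup>2))))"
proof -
  interpret w: weight k c T
    using assms(1-3) by unfold_locales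
  \<comment> \<open>\<open>g\<close> is prescribed only on \<open>[0, T]\<close> while
    \<open>w.g\<close> is a formula on the whole line; the integrals see only the interval.\<close>
  have g: "(LBINT t:{0..T}. f t * (g t)\<^sup>2) = (LBINT t:{0..T}. f t * (w.g t)\<^sup>2)" for f
    using assms(5) by (intro set_lebesgue_integral_cong) (auto simp: w.g_def)
  have m2: "m\<^sub>2 = w.m\<^sub>2"
    using g[of "\<lambda>_. 1"] assms(6) by (simp add: w.m\<^sub>2_def)
  have int: "1 / m\<^sub>2 * (LBINT t:{0..T}. f t * (g t)\<^sup>2) = (\<integral>t. f t \<partial>w.\<nu>)" if "f \<in> borel_measurable borel" for f
    unfolding g m2 using w.integral_nu[OF that] by simp
  have mu: "\<mu> = w.\<mu>" unfolding assms(7) w.\<mu>_def by (rule int) measurable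
  have sigma: "\<sigma>sq = w.\<sigma>sq" unfolding assms(8) w.\<sigma>sq_def mu by (subst int) auto
  have Z3: "Z\<^sub>3 = w.z3" unfolding assms(13) w.z3_def by (rule int) measurable
  have W: "W = w.W \<tau>" unfolding assms(14) w.W_def by (rule int) measurable
  have "V = c * (1 / m\<^sub>2 * (LBINT t:{0..T}. 1 / (2 * c + (real k - 1) * t) * (g t)\<^sup>2))" unfolding assms(16) by simp
  also have "\<dots> = c * w.v" unfolding w.v_def by (subst int) auto
  finally have V: "V = c * w.v" .
  have Z: "Z = 1 / \<tau> * (LBINT r:{1..1 + \<tau>}. w.z r)" unfolding assms(12) w.z_def mu sigma ..
  have trunc: "ereal (real k / (real k - 1) * ln (real k)) - M_trunc k T
    \<le> ereal (real k / (real k - 1) * ((Z + Z\<^sub>3 + W * X + V * U) /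
         ((1 + \<tau> / 2) * (1 - real k * \<sigma>sq / (1 + \<tau> - real k * \<mu>)\<^sup>2))))"
    using w.M_trunc_bound[OF assms(4)] assms(9-11)
    unfolding Z Z3 W V assms(15) assms(17) mu sigma by simp
  moreover have "ereal (real k / (real k - 1) * ln (real k)) - M_sup k \<le> ereal (real k / (real k - 1) * ln (real k)) - M_trunc k T"
    by (intro ereal_minus_mono order_refl w.M_trunc_le_M_sup)
  ultimately show ?thesis by (blast intro: order_trans)
qed

end
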